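(* There exist an AF C*-algebra $B$ and a maximal abelian self-adjoint subalgebra $D$ of $B$ such that $D$ is an AF C*-algebra, $D$ is regular in $B$ (its partial isometry normaliser generates $B$), and $D$ is not a standard regular masa in $B$. That is, a regular AF masa in an AF C*-algebra need not be standard regular.
   Context: For a masa $D$ (maximal abelian self-adjoint subalgebra) of $B$, the partial isometry normaliser $N_D(B)$ is the set of partial isometries $v\in B$ with $v^*Dv\subseteq D$ and $vDv^*\subseteq D$; $D$ is regular if $N_D(B)$ generates $B$ as a C*-algebra. A digraph algebra is a subalgebra $A$ of a finite-dimensional C*-algebra containing a masa of that C*-algebra; finite-dimensional C*-algebras are examples. $C^*(A)$ is the C*-algebra generated by $A$, a finite direct sum of full matrix algebras, where ranks are computed. A homomorphism of digraph algebras $\phi:A_1\to A_2$ is star-extendible if it is the restriction of a *-homomorphism $C^*(A_1)\to C^*(A_2)$. It has multiplicity one if $\phi(p)$ has rank at most one for each rank one projection $p\in A_1$, and it is regular if it is a sum of star-extendible multiplicity one maps $\phi_i$ with the projections $\phi_i(1)$ pairwise orthogonal. Given a direct system $\{A_k,\phi_k\}$ of digraph algebras with regular maps, and masas $C_k\subseteq A_k$ with $\phi_k(N_{C_k}(A_k))\subseteq N_{C_{k+1}}(A_{k+1})$ for all $k$, the closure of $\mathrm{alg\,lim}\,C_k$ in the closed limit algebra $\varinjlim(A_k,\phi_k)$ (norm closure in the C*-algebra limit of the $C^*(A_k)$) is a masa there. A masa $D$ in $B$ is standard regular if there are such a system and a star-extendible isomorphism (for C*-algebras: a *-isomorphism)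 of its closed limit onto $B$ carrying this masa onto $D$. *)

theory Defs
  imports
    "HOL-Analysis.Analysis"
    "Jordan_Normal_Form.DL_Rank"
    "Jordan_Normal_Form.Schur_Decomposition"
begin

section \<open>C*-algebras\<close>

text \<open>
  C*-algebras are carrier-based, built on the HOL-Algebra records for rings and modules; scalars are
  \<^term>\<open>class_ring :: complex ring\<close>. The field \<^const>\<open>one\<close> inherited from the ring record is never
  used, since C*-algebras need not be unital.
\<close>

record 'a cstar = "(complex, 'a) module" +
  adj :: "'a \<Rightarrow> 'a"
  cnorm :: "'a \<Rightarrow> real"

locale cstar_algebra = vectorspace "class_ring :: complex ring" B
  for B :: "('a, 'm) cstar_scheme" (structure) +
  assumes mult_closed: "\<lbrakk>x \<in> carrier B; y \<in> carrier B\<rbrakk> \<Longrightarrow> x \<otimes> y \<in> carrier B"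
    and mult_assoc: "\<lbrakk>x \<in> carrier B; y \<in> carrier B; z \<in> carrier B\<rbrakk> \<Longrightarrow> (x \<otimes> y) \<otimes> z = x \<otimes> (y \<otimes> z)"
    and mult_add_left:
      "\<lbrakk>x \<in> carrier B; y \<in> carrier B; z \<in> carrier B\<rbrakk> \<Longrightarrow> (x \<oplus> y) \<otimes> z = x \<otimes> z \<oplus> y \<otimes> z"
    and mult_add_right:
      "\<lbrakk>x \<in> carrier B; y \<in> carrier B; z \<in> carrier B\<rbrakk> \<Longrightarrow> x \<otimes> (y \<oplus> z) = x \<otimes> y \<oplus> x \<otimes> z"
    and mult_smult_left:
      "\<lbrakk>x \<in> carrier B; y \<in> carrier B\<rbrakk> \<Longrightarrow> (c \<odot>\<^bsub>B\<^esub> x) \<otimes> y = c \<odot>\<^bsub>B\<^esub> (x \<otimes> y)"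
    and mult_smult_right:
      "\<lbrakk>x \<in> carrier B; y \<in> carrier B\<rbrakk> \<Longrightarrow> x \<otimes> (c \<odot>\<^bsub>B\<^esub> y) = c \<odot>\<^bsub>B\<^esub> (x \<otimes> y)"
    and adj_closed: "x \<in> carrier B \<Longrightarrow> adj B x \<in> carrier B"
    and adj_adj: "x \<in> carrier B \<Longrightarrow> adj B (adj B x) = x"
    and adj_add: "\<lbrakk>x \<in> carrier B; y \<in> carrier B\<rbrakk> \<Longrightarrow> adj B (x \<oplus> y) = adj B x \<oplus> adj B y"
    and adj_smult: "x \<in> carrier B \<Longrightarrow> adj B (c \<odot>\<^bsub>B\<^esub> x) = cnj c \<odot>\<^bsub>B\<^esub> adj B x"
    and adj_mult: "\<lbrakk>x \<in> carrier B; y \<in> carrier B\<rbrakk> \<Longrightarrow> adj B (x \<otimes> y) = adj B y \<otimes> adj B x"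
    and cnorm_nonneg: "x \<in> carrier B \<Longrightarrow> 0 \<le> cnorm B x"
    and cnorm_eq_zero: "x \<in> carrier B \<Longrightarrow> cnorm B x = 0 \<longleftrightarrow> x = \<zero>"
    and cnorm_triangle:
      "\<lbrakk>x \<in> carrier B; y \<in> carrier B\<rbrakk> \<Longrightarrow> cnorm B (x \<oplus> y) \<le> cnorm B x + cnorm B y"
    and cnorm_smult: "x \<in> carrier B \<Longrightarrow> cnorm B (c \<odot>\<^bsub>B\<^esub> x) = cmod c * cnorm B x"
    and cnorm_mult:
      "\<lbrakk>x \<in> carrier B; y \<in> carrier B\<rbrakk> \<Longrightarrow> cnorm B (x \<otimes> y) \<le> cnorm B x * cnorm B y"
    and cnorm_cstar: "x \<in> carrier B \<Longrightarrow> cnorm B (adj B x \<otimes> x) = (cnorm B x)\<^sup>2"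
    and cnorm_complete:
      "\<lbrakk>\<And>n. X n \<in> carrier B; \<forall>e>0. \<exists>N. \<forall>m\<ge>N. \<forall>n\<ge>N. cnorm B (X m \<ominus> X n) < e\<rbrakk>
        \<Longrightarrow> \<exists>x\<in>carrier B. (\<lambda>n. cnorm B (X n \<ominus> x)) \<longlonglongrightarrow> 0"

text \<open>The same operations on a smaller carrier.\<close>

abbreviation on_carrier :: "('a, 'm) cstar_scheme \<Rightarrow> 'a set \<Rightarrow> ('a, 'm) cstar_scheme" where
  "on_carrier B S \<equiv> B\<lparr>carrier := S\<rparr>"

definition norm_closure :: "('a, 'm) cstar_scheme \<Rightarrow> 'a set \<Rightarrow> 'a set" where
  "norm_closure B S = {x \<in> carrier B. \<forall>e>0. \<exists>s\<in>S. cnorm B (x \<ominus>\<^bsub>B\<^esub> s) < e}"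

definition subalgebra :: "('a, 'm) cstar_scheme \<Rightarrow> 'a set \<Rightarrow> bool" where
  "subalgebra B S \<longleftrightarrow> subspace (class_ring :: complex ring) S B \<and> (\<forall>x\<in>S. \<forall>y\<in>S. x \<otimes>\<^bsub>B\<^esub> y \<in> S)"

definition star_subalgebra :: "('a, 'm) cstar_scheme \<Rightarrow> 'a set \<Rightarrow> bool" where
  "star_subalgebra B S \<longleftrightarrow> subalgebra B S \<and> (\<forall>x\<in>S. adj B x \<in> S)"

definition cstar_subalgebra :: "('a, 'm) cstar_scheme \<Rightarrow> 'a set \<Rightarrow> bool" where
  "cstar_subalgebra B S \<longleftrightarrow> star_subalgebra B S \<and> norm_closure B S = S"

definition generated_cstar :: "('a, 'm) cstar_scheme \<Rightarrow> 'a set \<Rightarrow> 'a set" where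
  "generated_cstar B S = \<Inter> {T. cstar_subalgebra B T \<and> S \<subseteq> T}"

definition finite_dim :: "('a, 'm) cstar_scheme \<Rightarrow> bool" where
  "finite_dim B \<longleftrightarrow> vectorspace.fin_dim (class_ring :: complex ring) B"

definition star_hom ::
  "('a, 'm) cstar_scheme \<Rightarrow> ('b, 'n) cstar_scheme \<Rightarrow> ('a \<Rightarrow> 'b) \<Rightarrow> bool" where
  "star_hom B E f \<longleftrightarrow>
     f \<in> carrier B \<rightarrow> carrier E \<and>
     (\<forall>x\<in>carrier B. \<forall>y\<in>carrier B. f (x \<oplus>\<^bsub>B\<^esub> y) = f x \<oplus>\<^bsub>E\<^esub> f y) \<and>
     (\<forall>c. \<forall>x\<in>carrier B. f (c \<odot>\<^bsub>B\<^esub> x) = c \<odot>\<^bsub>E\<^esub> f x) \<and>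
     (\<forall>x\<in>carrier B. \<forall>y\<in>carrier B. f (x \<otimes>\<^bsub>B\<^esub> y) = f x \<otimes>\<^bsub>E\<^esub> f y) \<and>
     (\<forall>x\<in>carrier B. f (adj B x) = adj E (f x))"

definition star_iso ::
  "('a, 'm) cstar_scheme \<Rightarrow> ('b, 'n) cstar_scheme \<Rightarrow> ('a \<Rightarrow> 'b) \<Rightarrow> bool" where
  "star_iso B E f \<longleftrightarrow> star_hom B E f \<and> bij_betw f (carrier B) (carrier E)"

definition AF_algebra :: "('a, 'm) cstar_scheme \<Rightarrow> bool" where
  "AF_algebra B \<longleftrightarrow> cstar_algebra B \<and>
     (\<exists>F :: nat \<Rightarrow> 'a set.
        (\<forall>n. cstar_subalgebra B (F n) \<and> finite_dim (on_carrier B (F n)) \<and> F n \<subseteq> F (Suc n)) \<and>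
        norm_closure B (\<Union>n. F n) = carrier B)"


section \<open>Masas and normalisers\<close>

definition projection :: "('a, 'm) cstar_scheme \<Rightarrow> 'a \<Rightarrow> bool" where
  "projection B p \<longleftrightarrow> p \<in> carrier B \<and> p \<otimes>\<^bsub>B\<^esub> p = p \<and> adj B p = p"

definition partial_isometry :: "('a, 'm) cstar_scheme \<Rightarrow> 'a \<Rightarrow> bool" where
  "partial_isometry B v \<longleftrightarrow> v \<in> carrier B \<and> projection B (adj B v \<otimes>\<^bsub>B\<^esub> v)"

definition abelian_star_subalgebra :: "('a, 'm) cstar_scheme \<Rightarrow> 'a set \<Rightarrow> bool" where
  "abelian_star_subalgebra B D \<longleftrightarrow>
     star_subalgebra B D \<and> (\<forall>x\<in>D. \<forall>y\<in>D. x \<otimes>\<^bsub>B\<^esub> y = y \<otimes>\<^bsub>B\<^esub> x)"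

text \<open>
  In the next two definitions \<open>A\<close> is a possibly non-self-adjoint subalgebra of the C*-algebra
  \<open>B\<close>, which supplies the involution. For a masa of \<open>B\<close> itself take \<open>A = carrier B\<close>.
\<close>

definition masa :: "('a, 'm) cstar_scheme \<Rightarrow> 'a set \<Rightarrow> 'a set \<Rightarrow> bool" where
  "masa B A D \<longleftrightarrow> abelian_star_subalgebra B D \<and> D \<subseteq> A \<and>
     (\<forall>D'. abelian_star_subalgebra B D' \<and> D' \<subseteq> A \<and> D \<subseteq> D' \<longrightarrow> D' = D)"

definition normaliser :: "('a, 'm) cstar_scheme \<Rightarrow> 'a set \<Rightarrow> 'a set \<Rightarrow> 'a set" where
  "normaliser B A D = {v \<in> A. partial_isometry B v \<and>
     (\<forall>d\<in>D. adj B v \<otimes>\<^bsub>B\<^esub> d \<otimes>\<^bsub>B\<^esub> v \<in> D) \<and> (\<forall>d\<in>D. v \<otimes>\<^bsub>B\<^esub> d \<otimes>\<^bsub>B\<^esub> adj B v \<in> D)}"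

definition regular_masa :: "('a, 'm) cstar_scheme \<Rightarrow> 'a set \<Rightarrow> bool" where
  "regular_masa B D \<longleftrightarrow> masa B (carrier B) D \<and>
     generated_cstar B (normaliser B (carrier B) D) = carrier B"


section \<open>Digraph algebras and regular maps\<close>

text \<open>A pair \<open>F\<close>, \<open>A\<close> with \<open>A\<close> a subalgebra of the finite-dimensional C*-algebra \<open>F\<close>.\<close>

definition digraph_algebra :: "('a, 'm) cstar_scheme \<Rightarrow> 'a set \<Rightarrow> bool" where
  "digraph_algebra F A \<longleftrightarrow> cstar_algebra F \<and> finite_dim F \<and> subalgebra F A \<and>
     (\<exists>M. masa F (carrier F) M \<and> M \<subseteq> A)"

abbreviation cstar_of :: "('a, 'm) cstar_scheme \<Rightarrow> 'a set \<Rightarrow> ('a, 'm) cstar_scheme" where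
  "cstar_of F A \<equiv> on_carrier F (generated_cstar F A)"

text \<open>
  \<open>\<psi>\<close> is a *-isomorphism of \<open>F\<close> onto the direct sum of the full matrix algebras of sizes
  \<open>n 0, \<dots>, n (m - 1)\<close>; \<open>\<psi> i x\<close> is the component of the image of \<open>x\<close> in the \<open>i\<close>-th summand.
\<close>

definition matrix_decomposition ::
  "('a, 'm) cstar_scheme \<Rightarrow> nat \<Rightarrow> (nat \<Rightarrow> nat) \<Rightarrow> (nat \<Rightarrow> 'a \<Rightarrow> complex mat) \<Rightarrow> bool" where
  "matrix_decomposition F m n \<psi> \<longleftrightarrow>
     (\<forall>i<m. n i > 0) \<and>
     bij_betw (\<lambda>x. \<lambda>i\<in>{..<m}. \<psi> i x) (carrier F) (\<Pi>\<^sub>E i\<in>{..<m}. carrier_mat (n i) (n i)) \<and>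
     (\<forall>i<m.
        (\<forall>x\<in>carrier F. \<forall>y\<in>carrier F. \<psi> i (x \<oplus>\<^bsub>F\<^esub> y) = \<psi> i x + \<psi> i y) \<and>
        (\<forall>c. \<forall>x\<in>carrier F. \<psi> i (c \<odot>\<^bsub>F\<^esub> x) = c \<cdot>\<^sub>m \<psi> i x) \<and>
        (\<forall>x\<in>carrier F. \<forall>y\<in>carrier F. \<psi> i (x \<otimes>\<^bsub>F\<^esub> y) = \<psi> i x * \<psi> i y) \<and>
        (\<forall>x\<in>carrier F. \<psi> i (adj F x) = mat_adjoint (\<psi> i x)))"

text \<open>
  The rank in a direct sum of full matrix algebras is the sum of the ranks of the components. It
  does not depend on the chosen decomposition.
\<close>

definition has_rank :: "('a, 'm) cstar_scheme \<Rightarrow> 'a \<Rightarrow> nat \<Rightarrow> bool" where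
  "has_rank F x r \<longleftrightarrow>
     (\<exists>m n \<psi>. matrix_decomposition F m n \<psi> \<and> (\<Sum>i<m. vec_space.rank (n i) (\<psi> i x)) = r)"

definition star_extendible ::
  "('a, 'm) cstar_scheme \<Rightarrow> 'a set \<Rightarrow> ('b, 'n) cstar_scheme \<Rightarrow> 'b set \<Rightarrow> ('a \<Rightarrow> 'b) \<Rightarrow> bool" where
  "star_extendible F\<^sub>1 A\<^sub>1 F\<^sub>2 A\<^sub>2 \<phi> \<longleftrightarrow> \<phi> \<in> A\<^sub>1 \<rightarrow> A\<^sub>2 \<and>
     (\<exists>\<Phi>. star_hom (cstar_of F\<^sub>1 A\<^sub>1) (cstar_of F\<^sub>2 A\<^sub>2) \<Phi> \<and> (\<forall>a\<in>A\<^sub>1. \<phi> a = \<Phi> a))"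

definition multiplicity_one ::
  "('a, 'm) cstar_scheme \<Rightarrow> 'a set \<Rightarrow> ('b, 'n) cstar_scheme \<Rightarrow> 'b set \<Rightarrow> ('a \<Rightarrow> 'b) \<Rightarrow> bool" where
  "multiplicity_one F\<^sub>1 A\<^sub>1 F\<^sub>2 A\<^sub>2 \<phi> \<longleftrightarrow> star_extendible F\<^sub>1 A\<^sub>1 F\<^sub>2 A\<^sub>2 \<phi> \<and>
     (\<forall>p\<in>A\<^sub>1. projection F\<^sub>1 p \<and> has_rank (cstar_of F\<^sub>1 A\<^sub>1) p 1 \<longrightarrow>
        (\<exists>r\<le>1. has_rank (cstar_of F\<^sub>2 A\<^sub>2) (\<phi> p) r))"

text \<open>
  A digraph algebra contains the unit \<open>e\<close> of its ambient C*-algebra, because a masa does; so \<open>e\<close>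
  below is the unique unit of \<open>A\<^sub>1\<close>.
\<close>

definition regular_map ::
  "('a, 'm) cstar_scheme \<Rightarrow> 'a set \<Rightarrow> ('b, 'n) cstar_scheme \<Rightarrow> 'b set \<Rightarrow> ('a \<Rightarrow> 'b) \<Rightarrow> bool" where
  "regular_map F\<^sub>1 A\<^sub>1 F\<^sub>2 A\<^sub>2 \<phi> \<longleftrightarrow>
     (\<exists>e\<in>A\<^sub>1. (\<forall>a\<in>A\<^sub>1. e \<otimes>\<^bsub>F\<^sub>1\<^esub> a = a \<and> a \<otimes>\<^bsub>F\<^sub>1\<^esub> e = a) \<and>
       (\<exists>(N :: nat) \<phi>s.
          (\<forall>i<N. multiplicity_one F\<^sub>1 A\<^sub>1 F\<^sub>2 A\<^sub>2 (\<phi>s i)) \<and>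
          (\<forall>i<N. \<forall>j<N. i \<noteq> j \<longrightarrow> \<phi>s i e \<otimes>\<^bsub>F\<^sub>2\<^esub> \<phi>s j e = \<zero>\<^bsub>F\<^sub>2\<^esub>) \<and>
          (\<forall>a\<in>A\<^sub>1. \<phi> a = (\<Oplus>\<^bsub>F\<^sub>2\<^esub> i\<in>{..<N}. \<phi>s i a))))"


section \<open>Direct limits and standard regular masas\<close>

primrec connecting :: "(nat \<Rightarrow> 'a \<Rightarrow> 'a) \<Rightarrow> nat \<Rightarrow> nat \<Rightarrow> 'a \<Rightarrow> 'a" where
  "connecting \<phi> k 0 x = x"
| "connecting \<phi> k (Suc j) x = \<phi> (k + j) (connecting \<phi> k j x)"

text \<open>
  \<open>L\<close> with the canonical maps \<open>\<mu> k\<close> is the C*-algebra limit of the system \<open>E k\<close>, \<open>\<phi> k\<close>: the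
  completion of the algebraic limit for the seminorm that sends the class of \<open>x \<in> E k\<close> to
  the limit of the norms of its images in \<open>E (k + j)\<close>. The maps \<open>\<phi> k\<close> need not be injective.
\<close>

definition cstar_limit ::
  "(nat \<Rightarrow> 'a cstar) \<Rightarrow> (nat \<Rightarrow> 'a \<Rightarrow> 'a) \<Rightarrow> 'b cstar \<Rightarrow> (nat \<Rightarrow> 'a \<Rightarrow> 'b) \<Rightarrow> bool" where
  "cstar_limit E \<phi> L \<mu> \<longleftrightarrow>
     (\<forall>k. cstar_algebra (E k) \<and> star_hom (E k) (E (Suc k)) (\<phi> k)) \<and>
     cstar_algebra L \<and>
     (\<forall>k. star_hom (E k) L (\<mu> k)) \<and>
     (\<forall>k. \<forall>x\<in>carrier (E k). \<mu> (Suc k) (\<phi> k x) = \<mu> k x) \<and>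
     (\<forall>k. \<forall>x\<in>carrier (E k).
        (\<lambda>j. cnorm (E (k + j)) (connecting \<phi> k j x)) \<longlonglongrightarrow> cnorm L (\<mu> k x)) \<and>
     norm_closure L (\<Union>k. \<mu> k ` carrier (E k)) = carrier L"

text \<open>
  Finite-dimensional C*-algebras and limits of sequences of them have at most continuum
  cardinality, so up to *-isomorphism their carriers are sets of complex sequences.
\<close>

type_synonym cstar_seq = "(nat \<Rightarrow> complex) cstar"

text \<open>
  The system consists of digraph algebras \<open>A k\<close> in \<open>F k\<close> with masas \<open>C k\<close>. The connecting
  homomorphisms \<open>\<phi> k\<close> are given with their unique star extensions to the generated C*-algebras;
  regularity concerns only their restrictions to \<open>A k\<close>. The closed limit of the \<open>A k\<close> and the limit
  masa are closures in the limit \<open>L\<close> of these C*-algebras.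
\<close>

definition standard_regular_masa :: "('a, 'm) cstar_scheme \<Rightarrow> 'a set \<Rightarrow> bool" where
  "standard_regular_masa B D \<longleftrightarrow> masa B (carrier B) D \<and>
     (\<exists>(F :: nat \<Rightarrow> cstar_seq) A C \<phi> (L :: cstar_seq) \<mu> \<psi>.
        (\<forall>k. digraph_algebra (F k) (A k) \<and> masa (F k) (A k) (C k)) \<and>
        cstar_limit (\<lambda>k. cstar_of (F k) (A k)) \<phi> L \<mu> \<and>
        (\<forall>k. \<phi> k ` A k \<subseteq> A (Suc k) \<and> regular_map (F k) (A k) (F (Suc k)) (A (Suc k)) (\<phi> k)) \<and>
        (\<forall>k. \<phi> k ` normaliser (F k) (A k) (C k)
               \<subseteq> normaliser (F (Suc k)) (A (Suc k)) (C (Suc k))) \<and>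
        (let A_lim = norm_closure L (\<Union>k. \<mu> k ` A k);
             C_lim = norm_closure L (\<Union>k. \<mu> k ` C k)
         in star_iso (cstar_of L A_lim) B \<psi> \<and> \<psi> ` A_lim = carrier B \<and> \<psi> ` C_lim = D))"

end

theory Submission
  imports Defs
begin

text \<open>
  The obstruction to being standard is the extension property: if two characters of \<open>B\<close> agree on a
  standard regular masa, they agree on \<open>B\<close>. For a masa \<open>M\<close> of a finite-dimensional star algebra this
  holds because a character that does not vanish on \<open>M\<close> is supported at a minimal projection
  \<open>p \<in> M\<close>, and \<open>p x p\<close> commutes with \<open>M\<close>, hence lies in \<open>M\<close>. In a digraph algebra \<open>A\<close> one
  passes from the given masa to \<open>A \<inter> A\<^sup>*\<close>, then to a masa of the ambient algebra, then to \<open>A\<close>; the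
  limit is reached because characters are contractive.

  The counterexample is the crossed product of \<open>C(X)\<close> by \<open>Z/2\<close>, where \<open>X\<close> is the one-point
  compactification of the natural numbers and the involution exchanges \<open>2k\<close> and \<open>2k + 1\<close>. It has
  the non-isolated fixed point at infinity, where evaluation of \<open>f + g u\<close> yields the two characters
  \<open>f(\<infinity>) + g(\<infinity>)\<close> and \<open>f(\<infinity>) - g(\<infinity>)\<close>. They agree on the regular AF masa \<open>C(X)\<close> but not on \<open>u\<close>.
\<close>

section \<open>Characters on finite-dimensional algebras\<close>

text \<open>Over a finite orbit the crossed product is a full 2x2 matrix algebra, which has no
  nonzero character; over infinity the fibre is the group algebra of Z/2, which has two. Because
  infinity is a limit of free orbits, commuting with the isolated points already forces
  \<open>g = 0\<close>, so \<open>C(X)\<close> is maximal abelian although it sees only scalars in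
  that fibre. The natural finite stages show the defect: each is a sum of matrix blocks and one copy
  of the group algebra, and the diagonal is not maximal abelian in the last summand. The extension
  property turns this observation into a statement about every possible system. On the general side
  the obstacle is that a standard system may consist of non-self-adjoint algebras, and that a
  character of \<open>B\<close> can be pulled back only to the part of each ambient algebra that
  lands in the closed limit. Hence the finite-dimensional lemma speaks of characters on a star
  subalgebra \<open>S\<close>. Units are not assumed, so they are constructed where needed.\<close>

lemma (in vectorspace) subspace_fin_dim:
  assumes "subspace K W V" and "fin_dim"
  shows "vectorspace.fin_dim K (vs W)"
proof -
  interpret W: vectorspace K "vs W" by (rule subspace_is_vs[OF assms(1)])
  have sm: "submodule K W V" using assms(1) by simp
  \<comment> \<open>Independence in \<open>W\<close> is independence in \<open>V\<close>, so
    \<open>dim\<close> bounds the independent subsets of \<open>W\<close>; a maximal one exists and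
    is a basis.\<close>
  have small: "finite A \<and> card A \<le> dim" if "A \<subseteq> W \<and> W.lin_indpt A" for A
  proof -
    have "lin_indpt A" using span_li_not_depend(2)[OF _ sm] that by blast
    moreover have "A \<subseteq> carrier V" using that submodule.subset[OF sm] by auto
    ultimately show ?thesis using li_le_dim[OF assms(2)] by blast
  qed
  have "\<exists>A. finite A \<and> maximal A (\<lambda>S. S \<subseteq> carrier (vs W) \<and> W.lin_indpt S)"
  proof (rule maximal_exists[where ?N = "dim" and ?B = "{}"])
    show "{} \<subseteq> carrier (vs W) \<and> W.lin_indpt {}" by (auto simp: W.lin_dep_def)
  next
    fix A assume "A \<subseteq> carrier (vs W) \<and> W.lin_indpt A"
    then show "finite A \<and> card A \<le> dim" using small by simp
  qed
  then show ?thesis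
    using W.max_li_is_basis unfolding W.fin_dim_def W.basis_def by blast
qed

text \<open>Rank-nullity gives the image the dimension of \<open>V\<close>, so a basis of the image
  is an independent set of full size in \<open>V\<close> and spans it.\<close>

lemma (in vectorspace) inj_endo_imp_surj:
  assumes "fin_dim" and "linear_map K V V T" and "inj_on T (carrier V)"
  shows "T ` carrier V = carrier V"
proof -
  interpret T: linear_map K V V T by fact
  have sm: "subspace K T.imT V" by (rule T.imT_is_subspace)
  interpret I: vectorspace K "vs T.imT" by (rule subspace_is_vs[OF sm])
  have sub: "submodule K T.imT V" using sm by simp
  have dim: "I.dim = dim"
    using T.rank_nullity[OF assms(1)] T.inj_imp_dim_ker0[OF assms(3)] by simp
  have "I.fin_dim" by (rule subspace_fin_dim[OF sm assms(1)])
  then obtain b where b: "finite b" "I.basis b" using I.finite_basis_exists by blast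
  have bi: "b \<subseteq> T.imT" using b by (simp add: I.basis_def)
  have bV: "b \<subseteq> carrier V" using bi submodule.subset[OF sub] by auto
  have li: "lin_indpt b"
    using b(2) span_li_not_depend(2)[OF bi sub] by (simp add: I.basis_def)
  have "basis b"
    by (rule dim_li_is_basis[OF assms(1) b(1) bV li]) (simp add: dim[symmetric] I.dim_basis[OF b])
  then have "carrier V \<subseteq> T.imT"
    using span_is_subset[OF bi sub] by (simp add: basis_def)
  then show ?thesis using submodule.subset[OF sub] unfolding T.im_def by auto
qed

section \<open>Elementary algebra in C*-algebras\<close>

context cstar_algebra
begin

lemma smult_carrier [simp, intro]: "x \<in> carrier B \<Longrightarrow> c \<odot>\<^bsub>B\<^esub> x \<in> carrier B"
  by (rule smult_closed) simp_all

declare mult_closed [simp, intro] adj_closed [simp, intro] adj_adj [simp]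

lemma minus_eq_smult: "\<lbrakk>x \<in> carrier B; y \<in> carrier B\<rbrakk> \<Longrightarrow> x \<ominus> y = x \<oplus> (- 1) \<odot>\<^bsub>B\<^esub> y"
  using smult_minus_1[of y] by (simp add: a_minus_def class_ring_simps)

lemma zero_smult [simp]: "x \<in> carrier B \<Longrightarrow> 0 \<odot>\<^bsub>B\<^esub> x = \<zero>"
  using smult_l_null[of x] by simp

lemma mult_zero_left [simp]: "x \<in> carrier B \<Longrightarrow> \<zero> \<otimes> x = \<zero>"
  using mult_smult_left[of \<zero> x 0] by simp

lemma mult_zero_right [simp]: "x \<in> carrier B \<Longrightarrow> x \<otimes> \<zero> = \<zero>"
  using mult_smult_right[of x \<zero> 0] by simp

lemma adj_zero [simp]: "adj B \<zero> = \<zero>"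
  using adj_smult[of \<zero> 0] by simp

lemma mult_minus_left:
  "\<lbrakk>x \<in> carrier B; y \<in> carrier B; z \<in> carrier B\<rbrakk> \<Longrightarrow> (x \<ominus> y) \<otimes> z = x \<otimes> z \<ominus> y \<otimes> z"
  by (simp add: minus_eq_smult mult_add_left mult_smult_left)

lemma mult_minus_right:
  "\<lbrakk>x \<in> carrier B; y \<in> carrier B; z \<in> carrier B\<rbrakk> \<Longrightarrow> x \<otimes> (y \<ominus> z) = x \<otimes> y \<ominus> x \<otimes> z"
  by (simp add: minus_eq_smult mult_add_right mult_smult_right)

lemma minus_eq_zero_iff: "\<lbrakk>x \<in> carrier B; y \<in> carrier B\<rbrakk> \<Longrightarrow> x \<ominus> y = \<zero> \<longleftrightarrow> x = y"
proof -
  assume [simp]: "x \<in> carrier B" "y \<in> carrier B"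
  have "x = (x \<ominus> y) \<oplus> y" by (simp add: a_minus_def a_assoc l_neg)
  then show ?thesis by (auto simp: a_minus_def r_neg)
qed

lemma minus_self [simp]: "x \<in> carrier B \<Longrightarrow> x \<ominus> x = \<zero>"
  by (simp add: minus_eq_zero_iff)

lemma adj_mult_self_eq_zero: "\<lbrakk>x \<in> carrier B; adj B x \<otimes> x = \<zero>\<rbrakk> \<Longrightarrow> x = \<zero>"
  using cnorm_cstar[of x] cnorm_eq_zero[of x] cnorm_eq_zero[of \<zero>] by simp

lemma cnorm_minus_commute:
  "\<lbrakk>x \<in> carrier B; y \<in> carrier B\<rbrakk> \<Longrightarrow> cnorm B (x \<ominus> y) = cnorm B (y \<ominus> x)"
proof -
  assume [simp]: "x \<in> carrier B" "y \<in> carrier B"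
  have "y \<ominus> x = (- 1) \<odot>\<^bsub>B\<^esub> (x \<ominus> y)"
    using smult_minus_1[of "x \<ominus> y"] by (simp add: class_ring_simps a_minus_def minus_add a_comm)
  then show ?thesis by (simp add: cnorm_smult)
qed

lemma cnorm_triangle_minus:
  assumes [simp]: "x \<in> carrier B" "y \<in> carrier B" "z \<in> carrier B"
  shows "cnorm B (x \<ominus> z) \<le> cnorm B (x \<ominus> y) + cnorm B (y \<ominus> z)"
proof -
  have "x \<ominus> z = (x \<ominus> y) \<oplus> (y \<ominus> z)"
    by (simp add: a_minus_def a_assoc r_neg1 r_neg2)
  then show ?thesis using cnorm_triangle[of "x \<ominus> y" "y \<ominus> z"] by simp
qed

lemma subspaceI:
  assumes "S \<subseteq> carrier B" "\<zero> \<in> S" "\<And>x y. \<lbrakk>x \<in> S; y \<in> S\<rbrakk> \<Longrightarrow> x \<oplus> y \<in> S"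
    "\<And>c x. x \<in> S \<Longrightarrow> c \<odot>\<^bsub>B\<^esub> x \<in> S"
  shows "subspace (class_ring :: complex ring) S B"
  unfolding subspace_def submodule_def
  using assms vectorspace_axioms module_axioms by auto

lemma subspaceD:
  assumes "subspace (class_ring :: complex ring) S B"
  shows "S \<subseteq> carrier B" "\<zero> \<in> S" "\<lbrakk>x \<in> S; y \<in> S\<rbrakk> \<Longrightarrow> x \<oplus> y \<in> S"
    "x \<in> S \<Longrightarrow> c \<odot>\<^bsub>B\<^esub> x \<in> S" "\<lbrakk>x \<in> S; y \<in> S\<rbrakk> \<Longrightarrow> x \<ominus> y \<in> S"
proof -
  have sm: "submodule (class_ring :: complex ring) S B" using assms by (simp add: subspace_def)
  show s: "S \<subseteq> carrier B" "\<zero> \<in> S" and a: "\<lbrakk>x \<in> S; y \<in> S\<rbrakk> \<Longrightarrow> x \<oplus> y \<in> S" for x y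
    using sm by (auto simp: submodule_def)
  show c: "x \<in> S \<Longrightarrow> c \<odot>\<^bsub>B\<^esub> x \<in> S" for c x
    using sm by (auto simp: submodule_def)
  show "x \<ominus> y \<in> S" if "x \<in> S" "y \<in> S"
    using a[OF that(1) c[OF that(2), of "-1"]] that s by (simp add: minus_eq_smult subset_iff)
qed

lemma subalgebraD:
  assumes "subalgebra B S"
  shows "S \<subseteq> carrier B" "\<zero> \<in> S" "\<lbrakk>x \<in> S; y \<in> S\<rbrakk> \<Longrightarrow> x \<oplus> y \<in> S"
    "x \<in> S \<Longrightarrow> c \<odot>\<^bsub>B\<^esub> x \<in> S" "\<lbrakk>x \<in> S; y \<in> S\<rbrakk> \<Longrightarrow> x \<ominus> y \<in> S"
    "\<lbrakk>x \<in> S; y \<in> S\<rbrakk> \<Longrightarrow> x \<otimes> y \<in> S"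
proof -
  have "subspace (class_ring :: complex ring) S B" using assms by (simp add: subalgebra_def)
  note d = subspaceD[OF this]
  show "S \<subseteq> carrier B" "\<zero> \<in> S" "\<lbrakk>x \<in> S; y \<in> S\<rbrakk> \<Longrightarrow> x \<oplus> y \<in> S"
    "x \<in> S \<Longrightarrow> c \<odot>\<^bsub>B\<^esub> x \<in> S" "\<lbrakk>x \<in> S; y \<in> S\<rbrakk> \<Longrightarrow> x \<ominus> y \<in> S"
    by (fact d)+
  show "\<lbrakk>x \<in> S; y \<in> S\<rbrakk> \<Longrightarrow> x \<otimes> y \<in> S" using assms by (simp add: subalgebra_def)
qed

lemma star_subalgebraI:
  assumes "S \<subseteq> carrier B" "\<zero> \<in> S" "\<And>x y. \<lbrakk>x \<in> S; y \<in> S\<rbrakk> \<Longrightarrow> x \<oplus> y \<in> S"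
    "\<And>c x. x \<in> S \<Longrightarrow> c \<odot>\<^bsub>B\<^esub> x \<in> S" "\<And>x y. \<lbrakk>x \<in> S; y \<in> S\<rbrakk> \<Longrightarrow> x \<otimes> y \<in> S"
    "\<And>x. x \<in> S \<Longrightarrow> adj B x \<in> S"
  shows "star_subalgebra B S"
  unfolding star_subalgebra_def subalgebra_def using assms by (auto intro!: subspaceI)

lemma star_subalgebraD:
  assumes "star_subalgebra B S"
  shows "S \<subseteq> carrier B" "\<zero> \<in> S" "\<lbrakk>x \<in> S; y \<in> S\<rbrakk> \<Longrightarrow> x \<oplus> y \<in> S"
    "x \<in> S \<Longrightarrow> c \<odot>\<^bsub>B\<^esub> x \<in> S" "\<lbrakk>x \<in> S; y \<in> S\<rbrakk> \<Longrightarrow> x \<ominus> y \<in> S"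
    "\<lbrakk>x \<in> S; y \<in> S\<rbrakk> \<Longrightarrow> x \<otimes> y \<in> S" "x \<in> S \<Longrightarrow> adj B x \<in> S"
proof -
  have "subalgebra B S" using assms by (simp add: star_subalgebra_def)
  note d = subalgebraD[OF this]
  show "S \<subseteq> carrier B" "\<zero> \<in> S" "\<lbrakk>x \<in> S; y \<in> S\<rbrakk> \<Longrightarrow> x \<oplus> y \<in> S"
    "x \<in> S \<Longrightarrow> c \<odot>\<^bsub>B\<^esub> x \<in> S" "\<lbrakk>x \<in> S; y \<in> S\<rbrakk> \<Longrightarrow> x \<ominus> y \<in> S"
    "\<lbrakk>x \<in> S; y \<in> S\<rbrakk> \<Longrightarrow> x \<otimes> y \<in> S"
    by (fact d)+
  show "x \<in> S \<Longrightarrow> adj B x \<in> S" using assms by (simp add: star_subalgebra_def)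
qed

section \<open>Commutants and maximal abelian subalgebras\<close>

text \<open>Self-adjointness of \<open>T\<close> makes the commutant closed under adjoints: take the
  adjoint of the relation between \<open>x\<close> and \<open>adj B t\<close>.\<close>

lemma star_subalgebra_commutant:
  assumes S: "star_subalgebra B S" and T: "T \<subseteq> carrier B" "\<And>t. t \<in> T \<Longrightarrow> adj B t \<in> T"
  shows "star_subalgebra B {x \<in> S. \<forall>t\<in>T. x \<otimes> t = t \<otimes> x}"
proof -
  note S = star_subalgebraD[OF S]
  have sc [simp]: "x \<in> carrier B" if "x \<in> S" for x using that S by blast
  have tc [simp]: "t \<in> carrier B" if "t \<in> T" for t using that T by blast
  show ?thesis
  proof (rule star_subalgebraI; (elim CollectE conjE)?; (intro CollectI conjI ballI)?)
    fix x y t assume x: "x \<in> S" "\<forall>t\<in>T. x \<otimes> t = t \<otimes> x" and y: "y \<in> S" "\<forall>t\<in>T. y \<otimes> t = t \<otimes> y"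
      and t: "t \<in> T"
    have "(x \<otimes> y) \<otimes> t = x \<otimes> (t \<otimes> y)" using x y t by (simp add: mult_assoc)
    also have "\<dots> = (t \<otimes> x) \<otimes> y" using x y t by (simp add: mult_assoc[symmetric])
    finally show "(x \<otimes> y) \<otimes> t = t \<otimes> (x \<otimes> y)" using x y t by (simp add: mult_assoc)
  next
    fix x t assume x: "x \<in> S" "\<forall>t\<in>T. x \<otimes> t = t \<otimes> x" and t: "t \<in> T"
    have "adj B (x \<otimes> adj B t) = adj B (adj B t \<otimes> x)" using x t T by simp
    then show "adj B x \<otimes> t = t \<otimes> adj B x" using x t by (simp add: adj_mult)
  qed (use S in \<open>auto simp: mult_add_left mult_add_right mult_smult_left mult_smult_right\<close>)
qed

text \<open>Adjoining \<open>y\<close> to \<open>M\<close> could produce a noncommutative star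
  algebra, because \<open>y\<close> need not be normal. Its real and imaginary parts are therefore
  adjoined separately.\<close>

lemma masa_commutant:
  assumes S: "star_subalgebra B S" and M: "masa B S M"
    and y: "y \<in> S" "\<And>m. m \<in> M \<Longrightarrow> y \<otimes> m = m \<otimes> y"
  shows "y \<in> M"
proof -
  note S' = star_subalgebraD[OF S]
  have Ms: "star_subalgebra B M" and MS: "M \<subseteq> S" and Mc: "\<And>x z. \<lbrakk>x \<in> M; z \<in> M\<rbrakk> \<Longrightarrow> x \<otimes> z = z \<otimes> x"
    and max: "\<And>D'. \<lbrakk>abelian_star_subalgebra B D'; D' \<subseteq> S; M \<subseteq> D'\<rbrakk> \<Longrightarrow> D' = M"
    using M unfolding masa_def abelian_star_subalgebra_def by blast+
  note M' = star_subalgebraD[OF Ms]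
  have sc [simp]: "x \<in> carrier B" if "x \<in> S" for x using that S' by blast
  have mc [simp]: "x \<in> carrier B" if "x \<in> M" for x using that M' by blast
  have selfadj: "h \<in> M" if h: "h \<in> S" "adj B h = h" "\<And>m. m \<in> M \<Longrightarrow> h \<otimes> m = m \<otimes> h" for h
  proof -
    \<comment> \<open>\<open>D\<close> is the bicommutant in \<open>S\<close> of the commuting self-adjoint set \<open>T\<close>, hence abelian.\<close>
    define T where "T = insert h M"
    define C where "C = {x \<in> S. \<forall>t\<in>T. x \<otimes> t = t \<otimes> x}"
    define D where "D = {x \<in> S. \<forall>t\<in>C. x \<otimes> t = t \<otimes> x}"
    have C: "star_subalgebra B C" unfolding C_def
      by (rule star_subalgebra_commutant[OF S]) (use h M' in \<open>auto simp: T_def\<close>)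
    have D: "star_subalgebra B D" unfolding D_def
      by (rule star_subalgebra_commutant[OF S]) (use star_subalgebraD[OF C] in auto)
    have TC: "T \<subseteq> C" using h Mc MS by (auto simp: T_def C_def)
    have TD: "T \<subseteq> D" using h MS by (auto simp: T_def C_def D_def)
    have DC: "D \<subseteq> C" using TC by (auto simp: C_def D_def)
    have "abelian_star_subalgebra B D"
      using D DC by (auto simp: abelian_star_subalgebra_def D_def)
    moreover have "D \<subseteq> S" by (auto simp: D_def)
    ultimately have "D = M" using TD max by (auto simp: T_def)
    then show ?thesis using TD by (auto simp: T_def)
  qed
  have comm: "adj B y \<otimes> m = m \<otimes> adj B y" if "m \<in> M" for m
    using arg_cong[OF y(2)[OF M'(7)[OF that]], of "adj B"] that y(1) by (simp add: adj_mult)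
  \<comment> \<open>The two self-adjoint elements are twice the real part of \<open>y\<close> and
    minus twice its imaginary part.\<close>
  have 1: "y \<oplus> adj B y \<in> M"
    by (rule selfadj) (use y comm S' in \<open>auto simp: adj_add mult_add_left mult_add_right a_comm\<close>)
  have 2: "\<i> \<odot>\<^bsub>B\<^esub> y \<oplus> (- \<i>) \<odot>\<^bsub>B\<^esub> adj B y \<in> M"
    by (rule selfadj) (use y comm S' in \<open>auto simp: adj_add adj_smult mult_add_left mult_add_right
        mult_smult_left mult_smult_right a_comm\<close>)
  have "y = (1/2) \<odot>\<^bsub>B\<^esub> ((y \<oplus> adj B y) \<oplus> (- \<i>) \<odot>\<^bsub>B\<^esub> (\<i> \<odot>\<^bsub>B\<^esub> y \<oplus> (- \<i>) \<odot>\<^bsub>B\<^esub> adj B y))"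
  proof -
    have *: "c \<odot>\<^bsub>B\<^esub> (d \<odot>\<^bsub>B\<^esub> x) = (c * d) \<odot>\<^bsub>B\<^esub> x" if "x \<in> carrier B" for c d x
      using smult_assoc1[of c d x] that by simp
    have **: "c \<odot>\<^bsub>B\<^esub> x \<oplus> d \<odot>\<^bsub>B\<^esub> x = (c + d) \<odot>\<^bsub>B\<^esub> x" if "x \<in> carrier B" for c d x
      using smult_l_distr[of c d x] that by simp
    have ***: "1 \<odot>\<^bsub>B\<^esub> x = x" if "x \<in> carrier B" for x using smult_one[of x] that by simp
    have r: "c \<odot>\<^bsub>B\<^esub> (x \<oplus> z) = c \<odot>\<^bsub>B\<^esub> x \<oplus> c \<odot>\<^bsub>B\<^esub> z" if "x \<in> carrier B" "z \<in> carrier B" for c x z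
      using smult_r_distr[of c x z] that by simp
    let ?y = "adj B y"
    have "(y \<oplus> ?y) \<oplus> (- \<i>) \<odot>\<^bsub>B\<^esub> (\<i> \<odot>\<^bsub>B\<^esub> y \<oplus> (- \<i>) \<odot>\<^bsub>B\<^esub> ?y) = (y \<oplus> ?y) \<oplus> (1 \<odot>\<^bsub>B\<^esub> y \<oplus> (-1) \<odot>\<^bsub>B\<^esub> ?y)"
      using y(1) by (simp add: r *)
    also have "\<dots> = (1 \<odot>\<^bsub>B\<^esub> y \<oplus> 1 \<odot>\<^bsub>B\<^esub> y) \<oplus> (1 \<odot>\<^bsub>B\<^esub> ?y \<oplus> (-1) \<odot>\<^bsub>B\<^esub> ?y)"
      using y(1) by (simp add: *** a_ac)
    also have "\<dots> = 2 \<odot>\<^bsub>B\<^esub> y" using y(1) by (simp add: ** )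
    finally show ?thesis using y(1) by (simp add: * *** )
  qed
  also have "\<dots> \<in> M" using 1 2 M'(3,4) by blast
  finally show ?thesis .
qed

text \<open>Elements of an abelian star algebra are normal, so the self-adjoint element
  \<open>adj B x \<otimes> x\<close> also has square zero; the C*-identity is then applied twice.
  The constructions of units rest on this absence of nilpotents.\<close>

lemma abelian_reduced:
  assumes M: "abelian_star_subalgebra B M" and x: "x \<in> M" "x \<otimes> x = \<zero>"
  shows "x = \<zero>"
proof -
  have Ms: "star_subalgebra B M" and Mc: "\<And>x z. \<lbrakk>x \<in> M; z \<in> M\<rbrakk> \<Longrightarrow> x \<otimes> z = z \<otimes> x"
    using M unfolding abelian_star_subalgebra_def by blast+
  note M' = star_subalgebraD[OF Ms]
  have c [simp]: "x \<in> carrier B" using x M' by blast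
  have "adj B (adj B x \<otimes> x) \<otimes> (adj B x \<otimes> x) = adj B x \<otimes> ((x \<otimes> adj B x) \<otimes> x)"
    by (simp add: adj_mult mult_assoc)
  also have "\<dots> = adj B x \<otimes> (adj B x \<otimes> (x \<otimes> x))"
    using Mc[OF x(1) M'(7)[OF x(1)]] by (simp add: mult_assoc)
  finally have "adj B (adj B x \<otimes> x) \<otimes> (adj B x \<otimes> x) = \<zero>" using x by simp
  then have "adj B x \<otimes> x = \<zero>" by (rule adj_mult_self_eq_zero[rotated]) simp
  then show ?thesis by (rule adj_mult_self_eq_zero[rotated]) simp
qed

end

text \<open>Characters are allowed to vanish identically.\<close>

definition character_on :: "('a, 'm) cstar_scheme \<Rightarrow> 'a set \<Rightarrow> ('a \<Rightarrow> complex) \<Rightarrow> bool" where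
  "character_on B S \<tau> \<longleftrightarrow>
     (\<forall>x\<in>S. \<forall>y\<in>S. \<tau> (x \<oplus>\<^bsub>B\<^esub> y) = \<tau> x + \<tau> y) \<and>
     (\<forall>c. \<forall>x\<in>S. \<tau> (c \<odot>\<^bsub>B\<^esub> x) = c * \<tau> x) \<and>
     (\<forall>x\<in>S. \<forall>y\<in>S. \<tau> (x \<otimes>\<^bsub>B\<^esub> y) = \<tau> x * \<tau> y)"

lemma character_on_subset: "character_on B S \<tau> \<Longrightarrow> T \<subseteq> S \<Longrightarrow> character_on B T \<tau>"
  unfolding character_on_def by blast

lemma norm_closure_mono: "S \<subseteq> T \<Longrightarrow> norm_closure B S \<subseteq> norm_closure B T"
  unfolding norm_closure_def by blast

section \<open>Units and characters in finite dimensions\<close>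

context cstar_algebra
begin

lemma character_on_minus:
  assumes "character_on B S \<tau>" "subalgebra B S" "x \<in> S" "y \<in> S"
  shows "\<tau> (x \<ominus> y) = \<tau> x - \<tau> y"
proof -
  have "x \<in> carrier B" "y \<in> carrier B" "(- 1) \<odot>\<^bsub>B\<^esub> y \<in> S"
    using subalgebraD[OF assms(2)] assms by auto
  then show ?thesis using assms by (simp add: minus_eq_smult character_on_def)
qed

text \<open>
  Multiplication by \<open>j\<close> is injective on the double annihilator of \<open>j\<close> in \<open>J\<close>, hence onto, and \<open>j\<close>
  itself lies there.
\<close>

lemma finite_dim_local_unit:
  assumes fd: "finite_dim B" and J: "subalgebra B J"
    and comm: "\<And>x y. \<lbrakk>x \<in> J; y \<in> J\<rbrakk> \<Longrightarrow> x \<otimes> y = y \<otimes> x"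
    and reduced: "\<And>x. \<lbrakk>x \<in> J; x \<otimes> x = \<zero>\<rbrakk> \<Longrightarrow> x = \<zero>"
    and j: "j \<in> J"
  shows "\<exists>e\<in>J. j \<otimes> e = j"
proof -
  note J' = subalgebraD[OF J]
  have jc [simp]: "x \<in> carrier B" if "x \<in> J" for x using that J' by blast
  define W where "W = {w \<in> J. \<forall>x\<in>J. j \<otimes> x = \<zero> \<longrightarrow> w \<otimes> x = \<zero>}"
  have W: "subspace class_ring W B"
    by (rule subspaceI) (use J' in \<open>auto simp: W_def mult_add_left mult_smult_left\<close>)
  note W' = subspaceD[OF W]
  have WJ: "x \<in> J" if "x \<in> W" for x using that by (simp add: W_def)
  have jW: "j \<otimes> w \<in> W" if w: "w \<in> W" for w
  proof -
    have "(j \<otimes> w) \<otimes> x = \<zero>" if x: "x \<in> J" "j \<otimes> x = \<zero>" for x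
      using comm[OF j WJ[OF w]] x j WJ[OF w] by (simp add: mult_assoc)
    then show ?thesis using j w J' by (auto simp: W_def)
  qed
  interpret W: vectorspace class_ring "vs W" by (rule subspace_is_vs[OF W])
  have lin: "linear_map class_ring (vs W) (vs W) ((\<otimes>) j)"
    unfolding linear_map_def mod_hom_def mod_hom_axioms_def module_hom_def
    using W.vectorspace_axioms W.module_axioms jW j WJ
    by (auto simp: mult_add_right mult_smult_right)
  have "inj_on ((\<otimes>) j) W"
  proof (rule inj_onI)
    fix v w assume v: "v \<in> W" and w: "w \<in> W" and eq: "j \<otimes> v = j \<otimes> w"
    have d: "v \<ominus> w \<in> W" using W'(5) v w by blast
    have "j \<otimes> (v \<ominus> w) = \<zero>" using eq v w WJ j by (simp add: mult_minus_right)
    \<comment> \<open>The difference is annihilated by \<open>j\<close>, and elements of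
      \<open>W\<close> kill whatever \<open>j\<close> annihilates in \<open>J\<close>; so the
      difference kills itself.\<close>
    then have "(v \<ominus> w) \<otimes> (v \<ominus> w) = \<zero>" using d WJ[OF d] by (simp add: W_def)
    then have "v \<ominus> w = \<zero>" using reduced WJ[OF d] by blast
    then show "v = w" using v w WJ minus_eq_zero_iff by simp
  qed
  then have "(\<otimes>) j ` W = W"
    using W.inj_endo_imp_surj[OF subspace_fin_dim[OF W] lin] fd
    by (simp add: finite_dim_def)
  moreover have "j \<in> W" using j by (simp add: W_def)
  ultimately obtain e where "e \<in> W" "j = j \<otimes> e" by (metis imageE)
  then show ?thesis using WJ by metis
qed

text \<open>Local units for the members of a finite spanning set are merged one by one. The elements
  fixed by the result form a subspace, so fixing a spanning set is enough.\<close>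

lemma finite_dim_unit:
  assumes fd: "finite_dim B" and J: "subalgebra B J"
    and comm: "\<And>x y. \<lbrakk>x \<in> J; y \<in> J\<rbrakk> \<Longrightarrow> x \<otimes> y = y \<otimes> x"
    and reduced: "\<And>x. \<lbrakk>x \<in> J; x \<otimes> x = \<zero>\<rbrakk> \<Longrightarrow> x = \<zero>"
  shows "\<exists>e\<in>J. \<forall>x\<in>J. e \<otimes> x = x"
proof -
  note J' = subalgebraD[OF J]
  have jc [simp]: "x \<in> carrier B" if "x \<in> J" for x using that J' by blast
  have Js: "subspace class_ring J B" using J by (simp add: subalgebra_def)
  interpret J: vectorspace class_ring "vs J" by (rule subspace_is_vs[OF Js])
  have "J.fin_dim" using subspace_fin_dim[OF Js] fd by (simp add: finite_dim_def)
  then obtain A where A: "finite A" "A \<subseteq> J" "J.span A = J"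
    unfolding J.fin_dim_def by auto
  have "span A = J" using A span_li_not_depend(1)[OF A(2)] Js by (simp add: subspace_def)
  have "\<exists>e\<in>J. \<forall>a\<in>A. e \<otimes> a = a" using A(1,2)
  proof (induction A rule: finite_induct)
    case empty then show ?case using J' by auto
  next
    case (insert a A)
    then obtain e where e: "e \<in> J" "\<And>a. a \<in> A \<Longrightarrow> e \<otimes> a = a" by auto
    have aJ: "a \<in> J" using insert.prems by simp
    obtain f where f: "f \<in> J" "a \<otimes> f = a"
      using finite_dim_local_unit[OF fd J comm reduced aJ] by blast
    \<comment> \<open>Formally \<open>1 - g = (1 - e)(1 - f)\<close>, so \<open>g\<close> fixes
      everything that \<open>e\<close> or \<open>f\<close> fixes.\<close>
    define g where "g = e \<oplus> (f \<ominus> e \<otimes> f)"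
    have gJ: "g \<in> J" unfolding g_def by (intro J'(3-6) e f)
    have g: "g \<otimes> h = e \<otimes> h \<oplus> (f \<otimes> h \<ominus> e \<otimes> (f \<otimes> h))" if "h \<in> J" for h
      using that e f J' unfolding g_def by (simp add: mult_add_left mult_minus_left mult_assoc)
    have "g \<otimes> h = h" if h: "h \<in> insert a A" for h
    proof (cases "h = a")
      case True
      have [simp]: "a \<in> J" "f \<otimes> a = a" using aJ comm[OF f(1) aJ] f by simp_all
      have "e \<otimes> a \<oplus> (a \<ominus> e \<otimes> a) = a"
        using e by (simp add: a_minus_def a_ac r_neg2 r_neg)
      then show ?thesis using g True by simp
    next
      case False
      then have hA: "h \<in> A" and hJ [simp]: "h \<in> J" using h insert.prems by auto
      have "e \<otimes> (f \<otimes> h) = (f \<otimes> e) \<otimes> h"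
        using comm[of e f] e f by (simp add: mult_assoc[symmetric])
      also have "\<dots> = f \<otimes> h" using e(1) f(1) e(2)[OF hA] by (simp add: mult_assoc)
      finally show ?thesis using g[OF hJ] e(2)[OF hA] f by simp
    qed
    then show ?case using gJ by blast
  qed
  then obtain e where e: "e \<in> J" "\<forall>a\<in>A. e \<otimes> a = a" by blast
  have "subspace class_ring {x \<in> J. e \<otimes> x = x} B"
    by (rule subspaceI) (use J' e in \<open>auto simp: mult_add_right mult_smult_right\<close>)
  then have "span A \<subseteq> {x \<in> J. e \<otimes> x = x}"
    using e A(2) by (intro span_is_subset) (auto simp: subspace_def)
  then show ?thesis using e(1) \<open>span A = J\<close> by blast
qed

text \<open>If \<open>\<tau>\<^sub>1\<close> kills the unit \<open>u\<close> of \<open>M\<close>, so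
  does \<open>\<tau>\<^sub>2\<close>; since \<open>u\<close> turns out to be a left unit of all of
  \<open>S\<close>, both characters vanish on \<open>S\<close>. Otherwise \<open>u\<close> has value
  1 and compression by a minimal projection applies.\<close>

lemma finite_dim_characters_agree:
  assumes fd: "finite_dim B" and S: "star_subalgebra B S" and M: "masa B S M"
    and \<tau>\<^sub>1: "character_on B S \<tau>\<^sub>1" and \<tau>\<^sub>2: "character_on B S \<tau>\<^sub>2"
    and eq: "\<And>m. m \<in> M \<Longrightarrow> \<tau>\<^sub>1 m = \<tau>\<^sub>2 m" and x: "x \<in> S"
  shows "\<tau>\<^sub>1 x = \<tau>\<^sub>2 x"
proof -
  note S' = star_subalgebraD[OF S]
  have Ma: "abelian_star_subalgebra B M" and MS: "M \<subseteq> S" using M unfolding masa_def by blast+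
  have Ms: "star_subalgebra B M" and Mc: "\<And>x z. \<lbrakk>x \<in> M; z \<in> M\<rbrakk> \<Longrightarrow> x \<otimes> z = z \<otimes> x"
    using Ma unfolding abelian_star_subalgebra_def by blast+
  note M' = star_subalgebraD[OF Ms]
  have Salg: "subalgebra B S" and Malg: "subalgebra B M"
    using S Ms by (simp_all add: star_subalgebra_def)
  have sc [simp]: "x \<in> carrier B" if "x \<in> S" for x using that S' by blast
  have ms [simp]: "x \<in> S" if "x \<in> M" for x using that MS by blast
  note red = abelian_reduced[OF Ma]
  have m1: "\<And>x y. \<lbrakk>x \<in> S; y \<in> S\<rbrakk> \<Longrightarrow> \<tau>\<^sub>1 (x \<otimes> y) = \<tau>\<^sub>1 x * \<tau>\<^sub>1 y"
    and m2: "\<And>x y. \<lbrakk>x \<in> S; y \<in> S\<rbrakk> \<Longrightarrow> \<tau>\<^sub>2 (x \<otimes> y) = \<tau>\<^sub>2 x * \<tau>\<^sub>2 y"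
    and s1: "\<And>c x. x \<in> S \<Longrightarrow> \<tau>\<^sub>1 (c \<odot>\<^bsub>B\<^esub> x) = c * \<tau>\<^sub>1 x"
    and a1: "\<And>x y. \<lbrakk>x \<in> S; y \<in> S\<rbrakk> \<Longrightarrow> \<tau>\<^sub>1 (x \<oplus> y) = \<tau>\<^sub>1 x + \<tau>\<^sub>1 y"
    using \<tau>\<^sub>1 \<tau>\<^sub>2 unfolding character_on_def by blast+
  note d1 = character_on_minus[OF \<tau>\<^sub>1 Salg]
  obtain u where u: "u \<in> M" "\<And>m. m \<in> M \<Longrightarrow> u \<otimes> m = m"
    using finite_dim_unit[OF fd Malg Mc red] by blast
  have uu: "\<tau>\<^sub>1 u * \<tau>\<^sub>1 u = \<tau>\<^sub>1 u" using m1[of u u] u by simp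
  show ?thesis
  proof (cases "\<tau>\<^sub>1 u = 0")
    case True
    \<comment> \<open>The aim is \<open>a = 0\<close>. Left multiplication by \<open>M\<close> kills
      \<open>a\<close>; multiplying \<open>a\<close> by its adjoint makes this two-sided, so the
      product commutes with \<open>M\<close> and lies in \<open>M\<close>, where \<open>u\<close>
      both fixes and kills it.\<close>
    define a where "a = x \<ominus> u \<otimes> x"
    have aS: "a \<in> S" unfolding a_def by (intro S'(3-6) x ms u)
    have ua: "u \<otimes> a = \<zero>"
      using x u u(2)[OF u(1)] by (simp add: a_def mult_minus_right mult_assoc[symmetric])
    have ma: "m \<otimes> a = \<zero>" if m: "m \<in> M" for m
    proof -
      have "m = m \<otimes> u" using u m Mc by metis
      then have "m \<otimes> a = m \<otimes> (u \<otimes> a)" using m u aS by (metis mult_assoc ms sc)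
      then show ?thesis using ua m by simp
    qed
    define b where "b = a \<otimes> adj B a"
    have bS: "b \<in> S" unfolding b_def by (intro S'(3-7) aS)
    have mb: "m \<otimes> b = \<zero>" if m: "m \<in> M" for m
      using ma[OF m] m aS by (simp add: b_def mult_assoc[symmetric])
    have bm: "b \<otimes> m = \<zero>" if m: "m \<in> M" for m
    proof -
      have "adj B (adj B m \<otimes> b) = b \<otimes> m" using m aS by (simp add: b_def adj_mult)
      then show ?thesis using mb[OF M'(7)[OF m]] by simp
    qed
    have "b \<in> M" by (rule masa_commutant[OF S M bS]) (simp add: mb bm)
    then have "b = \<zero>" using mb[OF u(1)] u(2) by simp
    then have "adj B (adj B a) \<otimes> adj B a = \<zero>" using aS by (simp add: b_def)
    then have "adj B a = \<zero>" using aS by (intro adj_mult_self_eq_zero[of "adj B a"]) simp_all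
    then have "a = \<zero>" using aS adj_adj[of a] by simp
    then have "x = u \<otimes> x" using x u minus_eq_zero_iff by (simp add: a_def)
    then have "\<tau>\<^sub>1 x = \<tau>\<^sub>1 u * \<tau>\<^sub>1 x" "\<tau>\<^sub>2 x = \<tau>\<^sub>2 u * \<tau>\<^sub>2 x"
      using m1[of u x] m2[of u x] x u by simp_all
    then show ?thesis using True eq[OF u(1)] by simp
  next
    case False
    then have u1: "\<tau>\<^sub>1 u = 1" using uu by simp
    define J where "J = {m \<in> M. \<tau>\<^sub>1 m = 0}"
    have "subspace class_ring J B"
    proof (rule subspaceI)
      show "J \<subseteq> carrier B" by (auto simp: J_def)
      show "\<zero> \<in> J" using d1[of u u] u M'(2) by (simp add: J_def)
      show "x \<oplus> y \<in> J" if "x \<in> J" "y \<in> J" for x y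
        using that a1[of x y] M'(3) by (simp add: J_def)
      show "c \<odot>\<^bsub>B\<^esub> x \<in> J" if "x \<in> J" for c x
        using that s1[of x c] M'(4) by (simp add: J_def)
    qed
    then have Jalg: "subalgebra B J" using M'(6) m1 by (auto simp: subalgebra_def J_def)
    obtain e where e: "e \<in> J" "\<And>j. j \<in> J \<Longrightarrow> e \<otimes> j = j"
      using finite_dim_unit[OF fd Jalg] Mc red unfolding J_def by blast
    have eM [simp]: "e \<in> M" using e by (simp add: J_def)
    \<comment> \<open>\<open>e\<close> is the unit of the kernel of \<open>\<tau>\<^sub>1\<close> on
      \<open>M\<close>. As \<open>M\<close> is this kernel plus the multiples of \<open>u\<close>,
      multiplying \<open>M\<close> by \<open>p\<close> leaves only scalar multiples of
      \<open>p\<close>.\<close>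
    define p where "p = u \<ominus> e"
    have pM: "p \<in> M" unfolding p_def by (intro M'(5) u eM)
    have p1: "\<tau>\<^sub>1 p = 1" using d1[of u e] u1 u e by (simp add: p_def J_def)
    have p2: "\<tau>\<^sub>2 p = 1" using p1 eq[OF pM] by simp
    have mp: "m \<otimes> p = \<tau>\<^sub>1 m \<odot>\<^bsub>B\<^esub> p" if m: "m \<in> M" for m
    proof -
      define j where "j = m \<ominus> \<tau>\<^sub>1 m \<odot>\<^bsub>B\<^esub> u"
      have jM: "j \<in> M" unfolding j_def by (intro M'(3-6) m u)
      have "\<tau>\<^sub>1 j = 0" using d1[of m "\<tau>\<^sub>1 m \<odot>\<^bsub>B\<^esub> u"] m u S'(4) u1 s1 by (simp add: j_def)
      then have jJ: "j \<in> J" using jM by (simp add: J_def)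
      have "j \<otimes> p = \<zero>"
        using jM u e(2)[OF jJ] u(2)[OF jM] Mc[OF jM u(1)] Mc[OF jM eM]
        by (simp add: p_def mult_minus_right)
      moreover have "j \<otimes> p = m \<otimes> p \<ominus> \<tau>\<^sub>1 m \<odot>\<^bsub>B\<^esub> p"
        using m u pM by (simp add: j_def mult_minus_left mult_smult_left)
      ultimately show ?thesis using m pM by (simp add: minus_eq_zero_iff)
    qed
    define y where "y = p \<otimes> (x \<otimes> p)"
    have yS: "y \<in> S" unfolding y_def by (intro S'(3-6) ms pM x)
    have "y \<otimes> m = m \<otimes> y" if m: "m \<in> M" for m
    proof -
      have "y \<otimes> m = p \<otimes> (x \<otimes> (p \<otimes> m))" using m pM x by (simp add: y_def mult_assoc)
      also have "\<dots> = \<tau>\<^sub>1 m \<odot>\<^bsub>B\<^esub> y"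
        using mp[OF m] Mc[OF pM m] m pM x by (simp add: y_def mult_smult_right)
      also have "\<dots> = (m \<otimes> p) \<otimes> (x \<otimes> p)"
        using mp[OF m] m pM x by (simp add: y_def mult_smult_left)
      finally show ?thesis using m pM x by (simp add: y_def mult_assoc)
    qed
    then have "y \<in> M" by (intro masa_commutant[OF S M yS])
    then have "\<tau>\<^sub>1 y = \<tau>\<^sub>2 y" by (rule eq)
    \<comment> \<open>Both characters take the value 1 at \<open>p\<close>, so compression by
      \<open>p\<close> does not change their value at \<open>x\<close>.\<close>
    then show ?thesis using m1 m2 p1 p2 pM x S'(6) by (simp add: y_def)
  qed
qed

section \<open>Norm closures and generated C*-subalgebras\<close>

lemma norm_closure_subset_carrier: "norm_closure B S \<subseteq> carrier B"
  by (auto simp: norm_closure_def)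

lemma norm_closure_superset: "S \<subseteq> carrier B \<Longrightarrow> S \<subseteq> norm_closure B S"
  using cnorm_eq_zero[of \<zero>] by (auto simp: norm_closure_def intro!: bexI)

lemma cstar_subalgebra_carrier: "cstar_subalgebra B (carrier B)"
  unfolding cstar_subalgebra_def
  using norm_closure_superset[of "carrier B"] norm_closure_subset_carrier
  by (auto intro!: star_subalgebraI)

lemma generated_cstar:
  assumes "S \<subseteq> carrier B"
  shows "cstar_subalgebra B (generated_cstar B S)" "S \<subseteq> generated_cstar B S"
proof -
  let ?F = "{T. cstar_subalgebra B T \<and> S \<subseteq> T}"
  \<comment> \<open>The family must have a member, since an empty intersection would be the whole
    type.\<close>
  have car: "carrier B \<in> ?F" using assms cstar_subalgebra_carrier by simp
  have T: "star_subalgebra B T" "norm_closure B T = T" if "T \<in> ?F" for T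
    using that by (simp_all add: cstar_subalgebra_def)
  have star: "star_subalgebra B (\<Inter>?F)"
  proof (rule star_subalgebraI)
    show "\<Inter>?F \<subseteq> carrier B" using car by blast
    show "\<zero> \<in> \<Inter>?F" using star_subalgebraD(2)[OF T(1)] by blast
    show "x \<oplus> y \<in> \<Inter>?F" if "x \<in> \<Inter>?F" "y \<in> \<Inter>?F" for x y
      using star_subalgebraD(3)[OF T(1)] that by blast
    show "c \<odot>\<^bsub>B\<^esub> x \<in> \<Inter>?F" if "x \<in> \<Inter>?F" for c x
      using star_subalgebraD(4)[OF T(1)] that by blast
    show "x \<otimes> y \<in> \<Inter>?F" if "x \<in> \<Inter>?F" "y \<in> \<Inter>?F" for x y
      using star_subalgebraD(6)[OF T(1)] that by blast
    show "adj B x \<in> \<Inter>?F" if "x \<in> \<Inter>?F" for x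
      using star_subalgebraD(7)[OF T(1)] that by blast
  qed
  have "norm_closure B (\<Inter>?F) \<subseteq> T" if "T \<in> ?F" for T
    using norm_closure_mono[of "\<Inter>?F" T B] T(2)[OF that] that by blast
  then have "norm_closure B (\<Inter>?F) = \<Inter>?F"
    using norm_closure_superset[of "\<Inter>?F"] star_subalgebraD(1)[OF star] by blast
  then show "cstar_subalgebra B (generated_cstar B S)"
    using star by (simp add: cstar_subalgebra_def generated_cstar_def)
  show "S \<subseteq> generated_cstar B S" by (auto simp: generated_cstar_def)
qed

end

section \<open>Characters and standard regular masas\<close>

text \<open>Boundedness comes from multiplicativity alone. The series starts at \<open>z\<close>
  because there may be no unit, and closedness of \<open>T\<close> keeps its sum in the domain of
  \<open>\<tau>\<close>.\<close>

lemma (in cstar_algebra) character_contractive: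
  assumes T: "subalgebra B T" "norm_closure B T = T" and \<tau>: "character_on B T \<tau>" and x: "x \<in> T"
  shows "cmod (\<tau> x) \<le> cnorm B x"
proof (rule ccontr)
  assume neg: "\<not> cmod (\<tau> x) \<le> cnorm B x"
  note T' = subalgebraD[OF T(1)]
  have tc [simp]: "x \<in> carrier B" if "x \<in> T" for x using that T' by blast
  define z where "z = (1 / \<tau> x) \<odot>\<^bsub>B\<^esub> x"
  define r where "r = cnorm B z"
  have "\<tau> x \<noteq> 0" using neg cnorm_nonneg[of x] x by auto
  then have \<tau>z: "\<tau> z = 1" using \<tau> x by (simp add: character_on_def z_def)
  have zT [simp]: "z \<in> T" unfolding z_def by (intro T'(4) x)
  have r0: "0 \<le> r" unfolding r_def by (simp add: cnorm_nonneg)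
  have r1: "r < 1"
    using neg x \<open>\<tau> x \<noteq> 0\<close> by (simp add: r_def z_def cnorm_smult norm_divide divide_simps)
  \<comment> \<open>The geometric series \<open>y = z + z\<^sup>2 + \<dots>\<close> solves \<open>y = z + z y\<close>, which is impossible if \<open>\<tau> z = 1\<close>.\<close>
  define s where "s = rec_nat z (\<lambda>_ y. z \<oplus> z \<otimes> y)"
  have s_0: "s 0 = z" and s_Suc: "s (Suc n) = z \<oplus> z \<otimes> s n" for n by (simp_all add: s_def)
  have sT [simp]: "s n \<in> T" for n
    by (induction n) (simp_all add: s_0 s_Suc T'(3,6))
  have step: "cnorm B ((z \<oplus> z \<otimes> v) \<ominus> (z \<oplus> z \<otimes> w)) \<le> r * cnorm B (v \<ominus> w)"
    if [simp]: "v \<in> carrier B" "w \<in> carrier B" for v w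
  proof -
    have "(z \<oplus> z \<otimes> v) \<ominus> (z \<oplus> z \<otimes> w) = z \<otimes> (v \<ominus> w)"
    proof -
      have "(z \<oplus> z \<otimes> v) \<ominus> (z \<oplus> z \<otimes> w) = (z \<oplus> \<ominus> z) \<oplus> (z \<otimes> v \<oplus> \<ominus> (z \<otimes> w))"
        by (simp add: a_minus_def minus_add a_ac)
      also have "\<dots> = z \<otimes> (v \<ominus> w)" by (subst mult_minus_right) (simp_all add: a_minus_def r_neg)
      finally show ?thesis .
    qed
    then show ?thesis using cnorm_mult[of z "v \<ominus> w"] by (simp add: r_def)
  qed
  \<comment> \<open>\<open>1 / (1 - r)\<close> is the sum of the full geometric series; the
    induction step reduces to \<open>0 \<le> (1 - r)^2\<close>.\<close>
  have bound: "cnorm B (s n) \<le> 1 / (1 - r)" for n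
  proof (induction n)
    case 0
    have "r * (1 - r) \<le> 1" using r0 r1 by (simp add: mult_le_one)
    then show ?case using r1 by (simp add: s_0 r_def[symmetric] pos_le_divide_eq)
  next
    case (Suc n)
    have "cnorm B (s (Suc n)) \<le> r + r * cnorm B (s n)"
      using cnorm_triangle[of z "z \<otimes> s n"] cnorm_mult[of z "s n"] by (simp add: s_Suc r_def)
    also have "\<dots> \<le> r + r * (1 / (1 - r))"
      using Suc r0 by (intro add_left_mono mult_left_mono)
    also have "\<dots> \<le> 1 / (1 - r)"
    proof -
      have "r + r * (1 / (1 - r)) = (2 * r - r * r) / (1 - r)"
        using r1 by (simp add: field_simps)
      moreover have "2 * r - r * r \<le> 1" using zero_le_power2[of "1 - r"]
        by (simp add: power2_eq_square algebra_simps)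
      ultimately show ?thesis using r1 by (simp add: divide_right_mono)
    qed
    finally show ?case .
  qed
  \<comment> \<open>Twice the bound on the partial sums, so that it controls the distance between
    any two of them.\<close>
  define C where "C = 2 / (1 - r)"
  have C0: "0 \<le> C" using r1 by (simp add: C_def)
  have diff: "cnorm B (s (n + k) \<ominus> s n) \<le> r ^ n * C" for n k
  proof (induction n)
    case 0
    have "cnorm B (s k \<ominus> s 0) \<le> cnorm B (s k \<ominus> \<zero>) + cnorm B (\<zero> \<ominus> s 0)"
      by (intro cnorm_triangle_minus) simp_all
    also have "\<dots> = cnorm B (s k) + cnorm B (s 0)"
    proof -
      have "v \<ominus> \<zero> = v" if "v \<in> carrier B" for v
        using that smult_r_null[of "-1"] by (simp add: minus_eq_smult)
      then show ?thesis using cnorm_minus_commute[of \<zero> "s 0"] by simp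
    qed
    also have "\<dots> \<le> C" using bound[of k] bound[of 0] by (simp add: C_def)
    finally show ?case by simp
  next
    case (Suc n)
    have "cnorm B (s (Suc n + k) \<ominus> s (Suc n)) \<le> r * cnorm B (s (n + k) \<ominus> s n)"
      using step[of "s (n + k)" "s n"] by (simp add: s_Suc)
    also have "\<dots> \<le> r * (r ^ n * C)" using Suc r0 by (intro mult_left_mono)
    finally show ?case by simp
  qed
  have "\<exists>y\<in>carrier B. (\<lambda>n. cnorm B (s n \<ominus> y)) \<longlonglongrightarrow> 0"
  proof (rule cnorm_complete)
    show "\<forall>e>0. \<exists>N. \<forall>m\<ge>N. \<forall>n\<ge>N. cnorm B (s m \<ominus> s n) < e"
    proof (intro allI impI)
      fix e :: real assume "e > 0"
      have "(\<lambda>n. r ^ n * C) \<longlonglongrightarrow> 0 * C"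
        using r0 r1 by (intro tendsto_mult LIMSEQ_power_zero tendsto_const) simp
      then have "eventually (\<lambda>n. r ^ n * C < e) sequentially"
        using \<open>e > 0\<close> by (auto dest: order_tendstoD(2))
      then obtain N where N: "\<And>n. n \<ge> N \<Longrightarrow> r ^ n * C < e"
        by (auto simp: eventually_sequentially)
      have le: "cnorm B (s m \<ominus> s n) < e" if "m \<ge> n" "n \<ge> N" for m n
        using diff[of n "m - n"] N[OF that(2)] that(1) by simp
      show "\<exists>N. \<forall>m\<ge>N. \<forall>n\<ge>N. cnorm B (s m \<ominus> s n) < e"
      proof (intro exI allI impI)
        fix m n assume "m \<ge> N" "n \<ge> N"
        then show "cnorm B (s m \<ominus> s n) < e"
          using le[of n m] le[of m n] cnorm_minus_commute[of "s m" "s n"] by (cases "m \<ge> n") simp_all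
      qed
    qed
  qed simp
  then obtain y where yc [simp]: "y \<in> carrier B" and y: "(\<lambda>n. cnorm B (s n \<ominus> y)) \<longlonglongrightarrow> 0" by blast
  have "\<exists>v\<in>T. cnorm B (y \<ominus> v) < e" if "e > 0" for e
  proof -
    have "eventually (\<lambda>n. cnorm B (s n \<ominus> y) < e) sequentially"
      using order_tendstoD(2)[OF y that] .
    then obtain n where "cnorm B (s n \<ominus> y) < e" by (auto simp: eventually_sequentially)
    then show ?thesis using cnorm_minus_commute[of y "s n"] by (intro bexI[of _ "s n"]) simp_all
  qed
  then have "y \<in> norm_closure B T" by (simp add: norm_closure_def)
  then have yT: "y \<in> T" using T by simp
  \<comment> \<open>The error of \<open>y\<close> in the equation \<open>y = z + z y\<close>.
    Comparison with the partial sums bounds its norm by a null sequence.\<close>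
  define d where "d = y \<ominus> (z \<oplus> z \<otimes> y)"
  have "cnorm B d \<le> cnorm B (s (Suc n) \<ominus> y) + r * cnorm B (s n \<ominus> y)" for n
  proof -
    have "cnorm B d \<le> cnorm B (y \<ominus> s (Suc n)) + cnorm B (s (Suc n) \<ominus> (z \<oplus> z \<otimes> y))"
      unfolding d_def by (rule cnorm_triangle_minus) simp_all
    then show ?thesis
      using step[of "s n" y] cnorm_minus_commute[of y "s (Suc n)"] by (simp add: s_Suc)
  qed
  moreover have "(\<lambda>n. cnorm B (s (Suc n) \<ominus> y) + r * cnorm B (s n \<ominus> y)) \<longlonglongrightarrow> 0 + r * 0"
    by (intro tendsto_intros LIMSEQ_Suc[OF y] y)
  ultimately have "cnorm B d \<le> 0" using LIMSEQ_le_const by fastforce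
  then have "d = \<zero>" using cnorm_nonneg[of d] cnorm_eq_zero[of d] by (simp add: d_def)
  then have "y = z \<oplus> z \<otimes> y" using minus_eq_zero_iff by (simp add: d_def)
  then have "\<tau> y = \<tau> z + \<tau> z * \<tau> y"
    using \<tau> zT yT T'(6)[OF zT yT] unfolding character_on_def by metis
  then show False using \<tau>z by simp
qed

lemma star_homD:
  assumes "star_hom B E f"
  shows "x \<in> carrier B \<Longrightarrow> f x \<in> carrier E"
    "\<lbrakk>x \<in> carrier B; y \<in> carrier B\<rbrakk> \<Longrightarrow> f (x \<oplus>\<^bsub>B\<^esub> y) = f x \<oplus>\<^bsub>E\<^esub> f y"
    "x \<in> carrier B \<Longrightarrow> f (c \<odot>\<^bsub>B\<^esub> x) = c \<odot>\<^bsub>E\<^esub> f x"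
    "\<lbrakk>x \<in> carrier B; y \<in> carrier B\<rbrakk> \<Longrightarrow> f (x \<otimes>\<^bsub>B\<^esub> y) = f x \<otimes>\<^bsub>E\<^esub> f y"
    "x \<in> carrier B \<Longrightarrow> f (adj B x) = adj E (f x)"
  using assms unfolding star_hom_def by auto

text \<open>A star-closed subset of \<open>A\<close> lies in \<open>S\<^sub>1\<close>; so
  \<open>C\<close>, maximal in \<open>A\<close>, is maximal in \<open>S\<^sub>1\<close>, and
  \<open>M\<close> lies there too. In turn \<open>M\<close>, maximal in all of \<open>F\<close>, is
  maximal in every \<open>S\<close> that contains it.\<close>

lemma digraph_algebra_characters_agree:
  assumes dig: "digraph_algebra F A" and C: "masa F A C"
    and S: "star_subalgebra F S" "A \<subseteq> S"
    and \<tau>\<^sub>1: "character_on F S \<tau>\<^sub>1" and \<tau>\<^sub>2: "character_on F S \<tau>\<^sub>2"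
    and eq: "\<And>c. c \<in> C \<Longrightarrow> \<tau>\<^sub>1 c = \<tau>\<^sub>2 c" and a: "a \<in> A"
  shows "\<tau>\<^sub>1 a = \<tau>\<^sub>2 a"
proof -
  interpret F: cstar_algebra F using dig by (simp add: digraph_algebra_def)
  have fd: "finite_dim F" and A: "subalgebra F A" using dig by (auto simp: digraph_algebra_def)
  obtain M where M: "masa F (carrier F) M" "M \<subseteq> A" using dig by (auto simp: digraph_algebra_def)
  note A' = F.subalgebraD[OF A]
  have Ac [simp]: "x \<in> carrier F" if "x \<in> A" for x using that A' by blast
  define S\<^sub>1 where "S\<^sub>1 = {x \<in> A. adj F x \<in> A}"
  have S\<^sub>1: "star_subalgebra F S\<^sub>1"
    by (rule F.star_subalgebraI)
       (use A'(1) in \<open>auto simp: S\<^sub>1_def A'(2-6) F.adj_add F.adj_smult F.adj_mult\<close>)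
  have sub: "X \<subseteq> S\<^sub>1" if "abelian_star_subalgebra F X" "X \<subseteq> A" for X
    using that by (auto simp: S\<^sub>1_def abelian_star_subalgebra_def star_subalgebra_def)
  have M1: "M \<subseteq> S\<^sub>1" using M by (intro sub) (simp_all add: masa_def)
  have "C \<subseteq> S\<^sub>1" using C by (intro sub) (simp_all add: masa_def)
  moreover have "S\<^sub>1 \<subseteq> A" by (auto simp: S\<^sub>1_def)
  ultimately have C1: "masa F S\<^sub>1 C" using C unfolding masa_def by (metis subset_trans)
  have S1S: "S\<^sub>1 \<subseteq> S" using S(2) by (auto simp: S\<^sub>1_def)
  have eqM: "\<tau>\<^sub>1 x = \<tau>\<^sub>2 x" if "x \<in> M" for x
    by (rule F.finite_dim_characters_agree[OF fd S\<^sub>1 C1 character_on_subset[OF \<tau>\<^sub>1 S1S]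
          character_on_subset[OF \<tau>\<^sub>2 S1S] eq subsetD[OF M1 that]])
  have MS: "masa F S M"
    using M S(2) F.star_subalgebraD(1)[OF S(1)] unfolding masa_def by (metis subset_trans)
  show ?thesis
    by (rule F.finite_dim_characters_agree[OF fd S(1) MS \<tau>\<^sub>1 \<tau>\<^sub>2 eqM subsetD[OF S(2) a]])
qed

text \<open>Pulled back along \<open>\<psi>\<close> and \<open>\<mu> k\<close>, the two characters
  agree on \<open>C k\<close>, because \<open>\<mu> k\<close> sends \<open>C k\<close> into the
  limit masa and \<open>\<psi>\<close> sends that to \<open>D\<close>.\<close>

lemma standard_regular_masa_characters_agree:
  assumes std: "standard_regular_masa B D"
    and \<tau>\<^sub>1: "character_on B (carrier B) \<tau>\<^sub>1" and \<tau>\<^sub>2: "character_on B (carrier B) \<tau>\<^sub>2"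
    and eq: "\<And>d. d \<in> D \<Longrightarrow> \<tau>\<^sub>1 d = \<tau>\<^sub>2 d" and b: "b \<in> carrier B"
  shows "\<tau>\<^sub>1 b = \<tau>\<^sub>2 b"
proof -
  obtain F :: "nat \<Rightarrow> cstar_seq" and A C \<phi> and L :: cstar_seq and \<mu> \<psi> A_lim C_lim where
    dig: "\<And>k. digraph_algebra (F k) (A k)" and masa: "\<And>k. masa (F k) (A k) (C k)"
    and lim: "cstar_limit (\<lambda>k. cstar_of (F k) (A k)) \<phi> L \<mu>"
    and A_lim: "A_lim = norm_closure L (\<Union>k. \<mu> k ` A k)"
    and C_lim: "C_lim = norm_closure L (\<Union>k. \<mu> k ` C k)"
    and \<psi>: "star_iso (cstar_of L A_lim) B \<psi>" and \<psi>A: "\<psi> ` A_lim = carrier B" and \<psi>C: "\<psi> ` C_lim = D"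
    using std unfolding standard_regular_masa_def Let_def by blast
  interpret L: cstar_algebra L using lim by (simp add: cstar_limit_def)
  have A_lim_carrier: "A_lim \<subseteq> carrier L"
    unfolding A_lim by (rule L.norm_closure_subset_carrier)
  define G where "G = generated_cstar L A_lim"
  have G: "star_subalgebra L G" "norm_closure L G = G" "A_lim \<subseteq> G"
    using L.generated_cstar[OF A_lim_carrier] by (simp_all add: G_def cstar_subalgebra_def)
  have \<psi>_hom: "star_hom (on_carrier L G) B \<psi>" and \<psi>_inj: "inj_on \<psi> G" and \<psi>_ran: "\<psi> ` G = carrier B"
    using \<psi> by (auto simp: star_iso_def bij_betw_def G_def)
  \<comment> \<open>\<open>\<psi>\<close> is injective on \<open>G\<close> and already maps the
    closed limit onto \<open>B\<close>, so nothing of \<open>G\<close> lies outside the closed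
    limit, which is therefore self-adjoint.\<close>
  have "G \<subseteq> A_lim"
  proof
    fix g assume g: "g \<in> G"
    then have "\<psi> g \<in> \<psi> ` A_lim" using \<psi>_ran \<psi>A by auto
    then obtain a where "a \<in> A_lim" "\<psi> g = \<psi> a" by blast
    then show "g \<in> A_lim" using \<psi>_inj g G(3) by (metis inj_onD subsetD)
  qed
  then have GA: "G = A_lim" using G(3) by blast
  note \<psi>' = star_homD[OF \<psi>_hom, simplified]
  have \<theta>: "character_on L G (\<tau> \<circ> \<psi>)" if "character_on B (carrier B) \<tau>" for \<tau>
    using that unfolding character_on_def by (simp add: \<psi>')
  have Galg: "subalgebra L G" using G(1) by (simp add: star_subalgebra_def)
  have Ac: "A k \<subseteq> carrier (F k)" for k
    using dig[of k] cstar_algebra.subalgebraD(1) by (auto simp: digraph_algebra_def)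
  have AE: "A k \<subseteq> generated_cstar (F k) (A k)" for k
    using cstar_algebra.generated_cstar(2)[OF _ Ac] dig[of k] by (simp add: digraph_algebra_def)
  have \<mu>_hom: "star_hom (cstar_of (F k) (A k)) L (\<mu> k)" for k
    using lim by (simp add: cstar_limit_def)
  have \<mu>_carrier: "\<mu> k x \<in> carrier L" if "x \<in> A k" for k x
    using star_homD(1)[OF \<mu>_hom, of x k] that AE[of k] by auto
  have CA: "C k \<subseteq> A k" for k using masa[of k] by (simp add: masa_def)
  have \<mu>A: "\<mu> k x \<in> A_lim" if "x \<in> A k" for k x
    unfolding A_lim using that \<mu>_carrier
    by (intro subsetD[OF L.norm_closure_superset[of "\<Union>k. \<mu> k ` A k"]]) auto
  have \<mu>C: "\<mu> k x \<in> C_lim" if "x \<in> C k" for k x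
    unfolding C_lim using that \<mu>_carrier CA
    by (intro subsetD[OF L.norm_closure_superset[of "\<Union>k. \<mu> k ` C k"]]) auto
  have agree: "(\<tau>\<^sub>1 \<circ> \<psi> \<circ> \<mu> k) a = (\<tau>\<^sub>2 \<circ> \<psi> \<circ> \<mu> k) a" if a: "a \<in> A k" for k a
  proof -
    interpret F: cstar_algebra "F k" using dig[of k] by (simp add: digraph_algebra_def)
    define E where "E = generated_cstar (F k) (A k)"
    have E: "star_subalgebra (F k) E" "A k \<subseteq> E"
      using F.generated_cstar[OF Ac] by (simp_all add: E_def cstar_subalgebra_def)
    note E' = F.star_subalgebraD[OF E(1)] and G' = L.star_subalgebraD[OF G(1)]
    note \<mu>' = star_homD[OF \<mu>_hom[of k, folded E_def], simplified]
    have \<mu>0: "\<mu> k \<zero>\<^bsub>F k\<^esub> = \<zero>\<^bsub>L\<^esub>"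
      using \<mu>'(3)[of "\<zero>\<^bsub>F k\<^esub>" 0] \<mu>'(1) E'(2) by simp
    \<comment> \<open>\<open>\<mu> k\<close> maps into \<open>L\<close>, but the pulled-back
      characters are multiplicative on \<open>G\<close> only; so their domain is cut down to the
      preimage of \<open>G\<close>, which still contains \<open>A k\<close>.\<close>
    define S where "S = {x \<in> E. \<mu> k x \<in> G}"
    have S: "star_subalgebra (F k) S"
    proof (rule F.star_subalgebraI)
      show "S \<subseteq> carrier (F k)" using E'(1) by (auto simp: S_def)
    qed (simp_all add: S_def E'(2-7) G'(2-7) \<mu>' \<mu>0)
    have AS: "A k \<subseteq> S" using E(2) \<mu>A GA by (auto simp: S_def)
    have ch: "character_on (F k) S (\<tau> \<circ> \<psi> \<circ> \<mu> k)" if "character_on B (carrier B) \<tau>" for \<tau>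
      using \<theta>[OF that] unfolding character_on_def by (simp add: S_def \<mu>')
    have "(\<tau>\<^sub>1 \<circ> \<psi> \<circ> \<mu> k) c = (\<tau>\<^sub>2 \<circ> \<psi> \<circ> \<mu> k) c" if "c \<in> C k" for c
      using \<mu>C[OF that] \<psi>C eq by auto
    then show ?thesis
      by (rule digraph_algebra_characters_agree[OF dig masa S AS ch[OF \<tau>\<^sub>1] ch[OF \<tau>\<^sub>2] _ a])
  qed
  obtain x where x: "x \<in> A_lim" "b = \<psi> x" using b \<psi>A by blast
  \<comment> \<open>By contractivity each character changes by less than \<open>e / 2\<close>
    between \<open>x\<close> and a nearby element coming from some \<open>A k\<close>, where the two
    agree.\<close>
  have "cmod (\<tau>\<^sub>1 b - \<tau>\<^sub>2 b) \<le> e" if "e > 0" for e :: real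
  proof -
    obtain k a where a: "a \<in> A k" "cnorm L (x \<ominus>\<^bsub>L\<^esub> \<mu> k a) < e / 2"
      using x(1) \<open>e > 0\<close> unfolding A_lim norm_closure_def by (auto dest!: spec[of _ "e / 2"])
    have "\<mu> k a \<in> G" using \<mu>A[OF a(1)] GA by simp
    have xG: "x \<in> G" "x \<ominus>\<^bsub>L\<^esub> \<mu> k a \<in> G"
      using x(1) GA L.subalgebraD(5)[OF Galg _ \<open>\<mu> k a \<in> G\<close>] by simp_all
    have *: "cmod (\<tau> (\<psi> x) - \<tau> (\<psi> (\<mu> k a))) < e / 2" if "character_on B (carrier B) \<tau>" for \<tau>
      using L.character_contractive[OF Galg G(2) \<theta>[OF that] xG(2)] a(2)
        L.character_on_minus[OF \<theta>[OF that] Galg xG(1) \<open>\<mu> k a \<in> G\<close>] by simp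
    show ?thesis
      using *[OF \<tau>\<^sub>1] *[OF \<tau>\<^sub>2] agree[OF a(1)] norm_triangle_ineq4[of "\<tau>\<^sub>1 (\<psi> x) - \<tau>\<^sub>1 (\<psi> (\<mu> k a))" "\<tau>\<^sub>2 (\<psi> x) - \<tau>\<^sub>2 (\<psi> (\<mu> k a))"]
      by (simp add: x(2))
  qed
  from this[of "cmod (\<tau>\<^sub>1 b - \<tau>\<^sub>2 b) / 2"] show ?thesis by (cases "\<tau>\<^sub>1 b = \<tau>\<^sub>2 b") simp_all
qed

section \<open>C*-subalgebras as C*-algebras\<close>

context cstar_algebra
begin

text \<open>Additive inverses are defined relative to the carrier, so shrinking it might change
  subtraction; writing it with the scalar \<open>- 1\<close> removes this dependence.\<close>

lemma minus_on_carrier: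
  assumes S: "subspace (class_ring :: complex ring) S B" and x: "x \<in> S" "y \<in> S"
  shows "x \<ominus>\<^bsub>on_carrier B S\<^esub> y = x \<ominus> y"
proof -
  interpret S: vectorspace "class_ring :: complex ring" "on_carrier B S" by (rule subspace_is_vs[OF S])
  have "\<ominus>\<^bsub>on_carrier B S\<^esub> y = (- 1) \<odot>\<^bsub>B\<^esub> y"
    using S.smult_minus_1[of y] x by (simp add: class_ring_simps)
  then show ?thesis
    using x subspaceD(1)[OF S] by (simp add: a_minus_def[of "on_carrier B S"] minus_eq_smult subset_iff)
qed

lemma cstar_algebra_on_carrier:
  assumes "cstar_subalgebra B S"
  shows "cstar_algebra (on_carrier B S)"
proof -
  have star: "star_subalgebra B S" and closed: "norm_closure B S = S"
    using assms by (simp_all add: cstar_subalgebra_def)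
  note S = star_subalgebraD[OF star]
  have sub: "subspace (class_ring :: complex ring) S B"
    using star by (simp add: star_subalgebra_def subalgebra_def)
  have [simp]: "x \<in> carrier B" if "x \<in> S" for x using that S(1) by blast
  interpret S: vectorspace "class_ring :: complex ring" "on_carrier B S" by (rule subspace_is_vs[OF sub])
  show ?thesis
  proof unfold_locales
    fix X :: "nat \<Rightarrow> 'a"
    assume X: "\<And>n. X n \<in> carrier (on_carrier B S)"
      and Cauchy: "\<forall>e>0. \<exists>N. \<forall>m\<ge>N. \<forall>n\<ge>N.
        cnorm (on_carrier B S) (X m \<ominus>\<^bsub>on_carrier B S\<^esub> X n) < e"
    have XS [simp]: "X n \<in> S" for n using X by simp
    obtain x where x: "x \<in> carrier B" "(\<lambda>n. cnorm B (X n \<ominus> x)) \<longlonglongrightarrow> 0"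
      using cnorm_complete[of X] Cauchy by (auto simp: minus_on_carrier[OF sub])
    have "\<exists>s\<in>S. cnorm B (x \<ominus> s) < e" if e: "e > 0" for e
    proof -
      obtain n where "cnorm B (X n \<ominus> x) < e"
        using order_tendstoD(2)[OF x(2) e] by (auto simp: eventually_sequentially)
      then show ?thesis using cnorm_minus_commute[of x "X n"] x(1) by (intro bexI[of _ "X n"]) simp_all
    qed
    then have "x \<in> norm_closure B S" using x(1) by (simp add: norm_closure_def)
    then have xS: "x \<in> S" using closed by simp
    show "\<exists>x\<in>carrier (on_carrier B S).
        (\<lambda>n. cnorm (on_carrier B S) (X n \<ominus>\<^bsub>on_carrier B S\<^esub> x)) \<longlonglongrightarrow> 0"
      using x(2) xS by (intro bexI[of _ x]) (simp_all add: minus_on_carrier[OF sub])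
  qed (simp_all add: S mult_assoc mult_add_left mult_add_right mult_smult_left mult_smult_right
      adj_add adj_smult adj_mult cnorm_nonneg cnorm_eq_zero cnorm_triangle cnorm_smult cnorm_mult cnorm_cstar)
qed

lemma norm_closure_on_carrier:
  assumes D: "subspace (class_ring :: complex ring) D B" and S: "S \<subseteq> D"
  shows "norm_closure (on_carrier B D) S = norm_closure B S \<inter> D"
  using subspaceD(1)[OF D] S
  by (auto simp: norm_closure_def minus_on_carrier[OF D] subset_iff)

lemma cstar_subalgebra_on_carrier:
  assumes D: "subspace (class_ring :: complex ring) D B" and S: "cstar_subalgebra B S" "S \<subseteq> D"
  shows "cstar_subalgebra (on_carrier B D) S"
proof -
  have "subspace (class_ring :: complex ring) S (on_carrier B D)"
    using S by (intro nested_subspaces[OF D]) (simp_all add: cstar_subalgebra_def star_subalgebra_def subalgebra_def)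
  then show ?thesis
    using S norm_closure_on_carrier[OF D S(2)]
    by (auto simp: cstar_subalgebra_def star_subalgebra_def subalgebra_def)
qed

text \<open>Spanning is phrased through arbitrary subspaces containing \<open>A\<close>, so that it
  can be checked without handling formal linear combinations.\<close>

lemma finite_dim_on_carrierI:
  assumes S: "subspace (class_ring :: complex ring) S B" and A: "finite A" "A \<subseteq> S"
    and gen: "\<And>W. \<lbrakk>subspace (class_ring :: complex ring) W B; A \<subseteq> W\<rbrakk> \<Longrightarrow> S \<subseteq> W"
  shows "finite_dim (on_carrier B S)"
proof -
  interpret S: vectorspace "class_ring :: complex ring" "on_carrier B S" by (rule subspace_is_vs[OF S])
  have Ac: "A \<subseteq> carrier B" using A(2) subspaceD(1)[OF S] by blast
  have sm: "submodule (class_ring :: complex ring) S B" using S by (simp add: subspace_def)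
  have "S \<subseteq> span A" by (rule gen[OF span_is_subspace[OF Ac] in_own_span[OF Ac]])
  then have "span A = S" using span_is_subset[OF A(2) sm] by blast
  then have "S.span A = S" using span_li_not_depend(1)[OF A(2) sm] by simp
  then show ?thesis using A unfolding finite_dim_def S.fin_dim_def by (intro exI[of _ A]) simp
qed

end

section \<open>The crossed product\<close>

text \<open>As operators on the Hilbert space of complex pairs, matrices receive the operator norm
  with its triangle inequality and submultiplicativity. The type only records real linearity, so
  complex homogeneity of the norm is shown separately.\<close>

definition mat2 :: "complex \<Rightarrow> complex \<Rightarrow> complex \<Rightarrow> complex \<Rightarrow> (complex \<times> complex) \<Rightarrow>\<^sub>L (complex \<times> complex)" where
  "mat2 a b c d = Blinfun (\<lambda>v. (a * fst v + b * snd v, c * fst v + d * snd v))"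

lemma mat2_apply: "blinfun_apply (mat2 a b c d) v = (a * fst v + b * snd v, c * fst v + d * snd v)"
proof -
  have "bounded_linear (\<lambda>v. (a * fst v + b * snd v, c * fst v + d * snd v))"
    by (intro bounded_linear_Pair bounded_linear_add bounded_linear_fst bounded_linear_snd
        bounded_linear_compose[OF bounded_linear_mult_right])
  then show ?thesis by (simp add: mat2_def bounded_linear_Blinfun_apply)
qed

lemma mat2_add: "mat2 a b c d + mat2 a' b' c' d' = mat2 (a + a') (b + b') (c + c') (d + d')"
  by (rule blinfun_eqI) (simp add: mat2_apply blinfun.add_left algebra_simps)

lemma mat2_mult:
  "mat2 a b c d o\<^sub>L mat2 a' b' c' d' =
    mat2 (a * a' + b * c') (a * b' + b * d') (c * a' + d * c') (c * b' + d * d')"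
  by (rule blinfun_eqI) (simp add: mat2_apply algebra_simps)

lemma norm_mat2_scale_le: "norm (mat2 (z * a) (z * b) (z * c) (z * d)) \<le> cmod z * norm (mat2 a b c d)"
proof (rule norm_blinfun_bound)
  fix v
  have "norm (blinfun_apply (mat2 (z * a) (z * b) (z * c) (z * d)) v)
      = norm (z * fst (blinfun_apply (mat2 a b c d) v), z * snd (blinfun_apply (mat2 a b c d) v))"
    by (simp add: mat2_apply algebra_simps)
  also have "\<dots> = cmod z * norm (blinfun_apply (mat2 a b c d) v)"
  proof -
    have "norm (z * p, z * q) = cmod z * norm (p, q)" for p q
    proof -
      have "(cmod (z * p))\<^sup>2 + (cmod (z * q))\<^sup>2 = (cmod z)\<^sup>2 * ((cmod p)\<^sup>2 + (cmod q)\<^sup>2)"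
        by (simp add: norm_mult power_mult_distrib algebra_simps)
      then show ?thesis by (simp add: norm_Pair real_sqrt_mult)
    qed
    then show ?thesis by (simp add: mat2_apply)
  qed
  also have "\<dots> \<le> cmod z * (norm (mat2 a b c d) * norm v)"
    by (intro mult_left_mono norm_blinfun norm_ge_zero)
  finally show "norm (blinfun_apply (mat2 (z * a) (z * b) (z * c) (z * d)) v)
      \<le> cmod z * norm (mat2 a b c d) * norm v" by (simp add: mult.assoc)
qed simp

lemma norm_mat2_scale: "norm (mat2 (z * a) (z * b) (z * c) (z * d)) = cmod z * norm (mat2 a b c d)"
proof (cases "z = 0")
  case True
  then show ?thesis using norm_mat2_scale_le[of z a b c d] by simp
next
  case False
  have "norm (mat2 a b c d) \<le> cmod (1 / z) * norm (mat2 (z * a) (z * b) (z * c) (z * d))"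
    using norm_mat2_scale_le[of "1 / z" "z * a" "z * b" "z * c" "z * d"] False by simp
  then have "cmod z * norm (mat2 a b c d) \<le> norm (mat2 (z * a) (z * b) (z * c) (z * d))"
    using False by (simp add: norm_divide field_simps)
  then show ?thesis using norm_mat2_scale_le[of z a b c d] by simp
qed

lemma norm_mat2_le: "norm (mat2 a b c d) \<le> cmod a + cmod b + cmod c + cmod d"
proof (rule norm_blinfun_bound)
  fix v :: "complex \<times> complex"
  have f: "cmod (fst v) \<le> norm v" and s: "cmod (snd v) \<le> norm v"
    using norm_fst_le[of "fst v" "snd v"] norm_snd_le[of "snd v" "fst v"] by simp_all
  have "norm (blinfun_apply (mat2 a b c d) v) \<le> cmod (a * fst v + b * snd v) + cmod (c * fst v + d * snd v)"
    by (simp add: mat2_apply norm_Pair_le)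
  also have "\<dots> \<le> (cmod (a * fst v) + cmod (b * snd v)) + (cmod (c * fst v) + cmod (d * snd v))"
    by (intro add_mono norm_triangle_ineq)
  also have "\<dots> \<le> (cmod a * norm v + cmod b * norm v) + (cmod c * norm v + cmod d * norm v)"
    unfolding norm_mult by (intro add_mono mult_left_mono f s norm_ge_zero)
  finally show "norm (blinfun_apply (mat2 a b c d) v) \<le> (cmod a + cmod b + cmod c + cmod d) * norm v"
    by (simp add: algebra_simps)
qed simp

text \<open>Evaluate at the two unit vectors. The first row suffices: in \<open>rep x k\<close> it
  consists of \<open>ev x k\<close> and \<open>od x k\<close>, so every coordinate of
  \<open>x\<close> occurs as \<open>k\<close> varies.\<close>

lemma norm_mat2_ge: "cmod a \<le> norm (mat2 a b c d)" "cmod b \<le> norm (mat2 a b c d)"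
proof -
  have "norm (blinfun_apply (mat2 a b c d) (1, 0)) \<le> norm (mat2 a b c d)"
    using norm_blinfun[of "mat2 a b c d" "(1, 0)"] by (simp add: norm_Pair)
  then show "cmod a \<le> norm (mat2 a b c d)"
    using norm_fst_le[of a c] by (simp add: mat2_apply)
  have "norm (blinfun_apply (mat2 a b c d) (0, 1)) \<le> norm (mat2 a b c d)"
    using norm_blinfun[of "mat2 a b c d" "(0, 1)"] by (simp add: norm_Pair)
  then show "cmod b \<le> norm (mat2 a b c d)"
    using norm_fst_le[of b d] by (simp add: mat2_apply)
qed

definition mat2_gram where
  "mat2_gram a b c d = mat2 (cnj a) (cnj c) (cnj b) (cnj d) o\<^sub>L mat2 a b c d"

text \<open>The squared norm of \<open>A v\<close> is the inner product of \<open>v\<close> with the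
  Gram matrix applied to \<open>v\<close>, and Cauchy-Schwarz bounds it. The real inner product
  serves, being the real part of the Hermitian one.\<close>

lemma norm_mat2_square_le: "(norm (mat2 a b c d))\<^sup>2 \<le> norm (mat2_gram a b c d)"
proof -
  let ?A = "mat2 a b c d" and ?G = "mat2_gram a b c d"
  have "norm ?A \<le> sqrt (norm ?G)"
  proof (rule norm_blinfun_bound)
    fix v
    have "(norm (blinfun_apply ?A v))\<^sup>2 = blinfun_apply ?A v \<bullet> blinfun_apply ?A v"
      by (rule power2_norm_eq_inner)
    also have "\<dots> = v \<bullet> blinfun_apply ?G v"
      by (cases v) (simp add: mat2_gram_def mat2_apply inner_complex_def algebra_simps)
    also have "\<dots> \<le> norm v * norm (blinfun_apply ?G v)" by (rule norm_cauchy_schwarz)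
    also have "\<dots> \<le> norm v * (norm ?G * norm v)" by (intro mult_left_mono norm_blinfun norm_ge_zero)
    finally have "(norm (blinfun_apply ?A v))\<^sup>2 \<le> norm ?G * (norm v)\<^sup>2"
      by (simp add: power2_eq_square algebra_simps)
    then have "norm (blinfun_apply ?A v) \<le> sqrt (norm ?G * (norm v)\<^sup>2)"
      by (rule real_le_rsqrt)
    then show "norm (blinfun_apply ?A v) \<le> sqrt (norm ?G) * norm v"
      by (simp add: real_sqrt_mult)
  qed simp
  then show ?thesis using power_mono[of "norm ?A" "sqrt (norm ?G)" 2] by simp
qed

text \<open>With \<open>A'\<close> the adjoint, \<open>|A|^2 \<le> |A' A| \<le> |A'| |A|\<close>;
  cancel \<open>|A|\<close>. Exchanging the roles of \<open>A\<close> and \<open>A'\<close> gives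
  the other half of the C*-identity.\<close>

lemma norm_mat2_adjoint_le: "norm (mat2 a b c d) \<le> norm (mat2 (cnj a) (cnj c) (cnj b) (cnj d))"
proof -
  let ?A = "mat2 a b c d" and ?A' = "mat2 (cnj a) (cnj c) (cnj b) (cnj d)"
  have "norm ?A * norm ?A \<le> norm ?A' * norm ?A"
    using norm_mat2_square_le[of a b c d] norm_blinfun_compose[of ?A' ?A]
    by (simp add: mat2_gram_def power2_eq_square)
  then show ?thesis by (cases "norm ?A = 0") simp_all
qed

lemma norm_mat2_gram: "norm (mat2_gram a b c d) = (norm (mat2 a b c d))\<^sup>2"
proof (rule antisym)
  show "norm (mat2_gram a b c d) \<le> (norm (mat2 a b c d))\<^sup>2"
    using norm_blinfun_compose[of "mat2 (cnj a) (cnj c) (cnj b) (cnj d)" "mat2 a b c d"]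
      norm_mat2_adjoint_le[of "cnj a" "cnj c" "cnj b" "cnj d"]
      mult_right_mono[of "norm (mat2 (cnj a) (cnj c) (cnj b) (cnj d))" "norm (mat2 a b c d)" "norm (mat2 a b c d)"]
    by (simp add: mat2_gram_def power2_eq_square)
qed (rule norm_mat2_square_le)

section \<open>The involution and the coding of elements\<close>

definition swap :: "nat \<Rightarrow> nat" where
  "swap k = (if even k then Suc k else k - 1)"

lemma swap_swap [simp]: "swap (swap k) = k"
  by (auto simp: swap_def elim: oddE)

lemma swap_neq [simp]: "swap k \<noteq> k" "k \<noteq> swap k"
  by (auto simp: swap_def elim: oddE)

text \<open>A tail starting at an even index is a union of orbits; this is why the finite stages are
  cut at \<open>2 * n\<close>.\<close>

lemma swap_ge: "2 * n \<le> k \<Longrightarrow> 2 * n \<le> swap k"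
  by (auto simp: swap_def elim!: oddE)

text \<open>The involution extends continuously to the point at infinity and fixes it: composition
  with \<open>swap\<close> preserves limits.\<close>

lemma filterlim_swap: "filterlim swap sequentially sequentially"
  unfolding filterlim_at_top
proof
  fix n show "eventually (\<lambda>k. n \<le> swap k) sequentially"
    using eventually_ge_at_top[of "Suc n"] by eventually_elim (auto simp: swap_def)
qed

text \<open>A pair \<open>(f, g)\<close> of sequences, standing for \<open>f + g u\<close>, is coded by the sequence \<open>join f g\<close>.\<close>

definition ev :: "(nat \<Rightarrow> complex) \<Rightarrow> nat \<Rightarrow> complex" where "ev x k = x (2 * k)"
definition od :: "(nat \<Rightarrow> complex) \<Rightarrow> nat \<Rightarrow> complex" where "od x k = x (Suc (2 * k))"
definition join :: "(nat \<Rightarrow> complex) \<Rightarrow> (nat \<Rightarrow> complex) \<Rightarrow> nat \<Rightarrow> complex" where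
  "join f g i = (if even i then f (i div 2) else g (i div 2))"

lemma ev_join [simp]: "ev (join f g) = f" and od_join [simp]: "od (join f g) = g"
  by (auto simp: ev_def od_def join_def)

lemma ev_od_eqI: "(\<And>k. ev x k = ev y k) \<Longrightarrow> (\<And>k. od x k = od y k) \<Longrightarrow> x = y"
proof
  fix i assume "\<And>k. ev x k = ev y k" "\<And>k. od x k = od y k"
  from this[of "i div 2"] show "x i = y i" by (cases "even i") (auto simp: ev_def od_def)
qed

lemma forall_ev_od: "(\<forall>i. P (x i)) \<longleftrightarrow> (\<forall>k. P (ev x k) \<and> P (od x k))"
proof
  assume *: "\<forall>k. P (ev x k) \<and> P (od x k)"
  show "\<forall>i. P (x i)"
  proof
    fix i from *[rule_format, of "i div 2"] show "P (x i)"
      by (cases "even i") (auto simp: ev_def od_def)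
  qed
qed (auto simp: ev_def od_def)

text \<open>
  With \<open>f = ev x\<close> and \<open>g = od x\<close>, the element \<open>f + g u\<close> acts on the orbit \<open>{k, swap k}\<close> by this matrix.
\<close>

definition rep :: "(nat \<Rightarrow> complex) \<Rightarrow> nat \<Rightarrow> (complex \<times> complex) \<Rightarrow>\<^sub>L (complex \<times> complex)" where
  "rep x k = mat2 (ev x k) (od x k) (od x (swap k)) (ev x (swap k))"

text \<open>The product is forced by \<open>u f = (f \<circ> swap) u\<close> and
  \<open>u u = 1\<close>, and so is the shift in the adjoint of \<open>g u\<close>. Convergence of
  both sequences is continuity on \<open>X\<close>. The supremum runs over finite points only, since
  the fibre at infinity is a limit of the matrices \<open>rep x k\<close> and cannot increase
  it.\<close>

definition swap_algebra :: "(nat \<Rightarrow> complex) cstar" where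
  "swap_algebra = \<lparr>carrier = {x. convergent (ev x) \<and> convergent (od x)},
     mult = (\<lambda>x y. join (\<lambda>k. ev x k * ev y k + od x k * od y (swap k))
                        (\<lambda>k. ev x k * od y k + od x k * ev y (swap k))),
     one = join (\<lambda>_. 1) (\<lambda>_. 0),
     zero = (\<lambda>_. 0),
     add = (\<lambda>x y i. x i + y i),
     smult = (\<lambda>c x i. c * x i),
     adj = (\<lambda>x. join (\<lambda>k. cnj (ev x k)) (\<lambda>k. cnj (od x (swap k)))),
     cnorm = (\<lambda>x. SUP k. norm (rep x k))\<rparr>"

lemma swap_algebra_simps:
  "carrier swap_algebra = {x. convergent (ev x) \<and> convergent (od x)}"
  "\<zero>\<^bsub>swap_algebra\<^esub> = (\<lambda>_. 0)"
  "x \<oplus>\<^bsub>swap_algebra\<^esub> y = (\<lambda>i. x i + y i)"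
  "c \<odot>\<^bsub>swap_algebra\<^esub> x = (\<lambda>i. c * x i)"
  "cnorm swap_algebra x = (SUP k. norm (rep x k))"
  by (simp_all add: swap_algebra_def)

lemma ev_simps [simp]:
  "ev (\<lambda>_. 0) k = 0" "ev (\<lambda>i. x i + y i) k = ev x k + ev y k" "ev (\<lambda>i. c * x i) k = c * ev x k"
  "ev (x \<otimes>\<^bsub>swap_algebra\<^esub> y) k = ev x k * ev y k + od x k * od y (swap k)"
  "ev (adj swap_algebra x) k = cnj (ev x k)"
  by (simp_all add: swap_algebra_def) (simp_all add: ev_def)

lemma od_simps [simp]:
  "od (\<lambda>_. 0) k = 0" "od (\<lambda>i. x i + y i) k = od x k + od y k" "od (\<lambda>i. c * x i) k = c * od x k"
  "od (x \<otimes>\<^bsub>swap_algebra\<^esub> y) k = ev x k * od y k + od x k * ev y (swap k)"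
  "od (adj swap_algebra x) k = cnj (od x (swap k))"
  by (simp_all add: swap_algebra_def) (simp_all add: od_def)

lemma swap_algebra_carrierI:
  assumes "\<And>k. ev x k = f k" "\<And>k. od x k = g k" "f \<longlonglongrightarrow> a" "g \<longlonglongrightarrow> b"
  shows "x \<in> carrier swap_algebra"
proof -
  have "ev x = f" "od x = g" using assms by auto
  then show ?thesis using assms by (auto simp: swap_algebra_simps convergent_def)
qed

lemma swap_algebra_carrierE:
  assumes "x \<in> carrier swap_algebra"
  obtains a b where "ev x \<longlonglongrightarrow> a" "od x \<longlonglongrightarrow> b"
    "(\<lambda>k. ev x (swap k)) \<longlonglongrightarrow> a" "(\<lambda>k. od x (swap k)) \<longlonglongrightarrow> b"
proof -
  obtain a b where ab: "ev x \<longlonglongrightarrow> a" "od x \<longlonglongrightarrow> b"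
    using assms by (auto simp: swap_algebra_simps convergent_def)
  show ?thesis
    using that[OF ab] filterlim_compose[OF ab(1) filterlim_swap] filterlim_compose[OF ab(2) filterlim_swap]
    by simp
qed

section \<open>Norm estimates and closure properties\<close>

lemma rep_add: "rep (\<lambda>i. x i + y i) k = rep x k + rep y k"
  by (simp add: rep_def mat2_add)

lemma rep_mult: "rep (x \<otimes>\<^bsub>swap_algebra\<^esub> y) k = rep x k o\<^sub>L rep y k"
  by (simp add: rep_def mat2_mult algebra_simps)

lemma norm_rep_scale: "norm (rep (\<lambda>i. c * x i) k) = cmod c * norm (rep x k)"
  by (simp add: rep_def norm_mat2_scale)

lemma norm_rep_gram: "norm (rep (adj swap_algebra x \<otimes>\<^bsub>swap_algebra\<^esub> x) k) = (norm (rep x k))\<^sup>2"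
proof -
  have "rep (adj swap_algebra x \<otimes>\<^bsub>swap_algebra\<^esub> x) k
      = mat2_gram (ev x k) (od x k) (od x (swap k)) (ev x (swap k))"
    unfolding rep_mult by (simp add: rep_def mat2_gram_def)
  then show ?thesis by (simp add: norm_mat2_gram rep_def)
qed

lemma norm_rep_le: "(\<And>i. cmod (x i) \<le> e) \<Longrightarrow> norm (rep x k) \<le> 4 * e"
  using norm_mat2_le[of "ev x k" "od x k" "od x (swap k)" "ev x (swap k)"]
  by (smt (verit) rep_def ev_def od_def)

lemma norm_rep_bdd_above:
  assumes "x \<in> carrier swap_algebra"
  shows "bdd_above (range (\<lambda>k. norm (rep x k)))"
proof -
  obtain M where M: "\<And>k. cmod (ev x k) \<le> M"
    using assms convergent_imp_Bseq by (force simp: swap_algebra_simps Bseq_def)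
  obtain N where N: "\<And>k. cmod (od x k) \<le> N"
    using assms convergent_imp_Bseq by (force simp: swap_algebra_simps Bseq_def)
  have "\<forall>i. cmod (x i) \<le> max M N"
    unfolding forall_ev_od[of "\<lambda>z. cmod z \<le> max M N"] using M N by (auto intro: max.coboundedI1 max.coboundedI2)
  then show ?thesis using norm_rep_le by (intro bdd_aboveI2[of _ _ "4 * max M N"]) blast
qed

lemma norm_rep_le_cnorm: "x \<in> carrier swap_algebra \<Longrightarrow> norm (rep x k) \<le> cnorm swap_algebra x"
  unfolding swap_algebra_simps(5) by (rule cSUP_upper[OF _ norm_rep_bdd_above]) simp_all

lemma cnorm_swap_le: "(\<And>k. norm (rep x k) \<le> e) \<Longrightarrow> cnorm swap_algebra x \<le> e"
  unfolding swap_algebra_simps(5) by (rule cSUP_least) simp_all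

text \<open>Together with \<open>cnorm_le_cmod\<close> this makes the C*-norm equivalent to the
  supremum norm of the coding sequence, with constants 1 and 4 (one for each matrix entry). Limits
  and approximations are then computed in the supremum norm.\<close>

lemma cmod_le_cnorm:
  assumes x: "x \<in> carrier swap_algebra"
  shows "cmod (x i) \<le> cnorm swap_algebra x"
proof -
  have "cmod (ev x k) \<le> cnorm swap_algebra x \<and> cmod (od x k) \<le> cnorm swap_algebra x" for k
    using norm_mat2_ge[where a = "ev x k" and b = "od x k" and c = "od x (swap k)" and d = "ev x (swap k)"]
      norm_rep_le_cnorm[OF x, of k] by (simp add: rep_def)
  then show ?thesis using forall_ev_od[of "\<lambda>z. cmod z \<le> cnorm swap_algebra x" x] by blast
qed

lemma cnorm_le_cmod: "(\<And>i. cmod (x i) \<le> e) \<Longrightarrow> cnorm swap_algebra x \<le> 4 * e"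
  by (intro cnorm_swap_le norm_rep_le)

lemma swap_algebra_closed:
  assumes x: "x \<in> carrier swap_algebra" and y: "y \<in> carrier swap_algebra"
  shows "x \<otimes>\<^bsub>swap_algebra\<^esub> y \<in> carrier swap_algebra" "(\<lambda>i. x i + y i) \<in> carrier swap_algebra"
    "(\<lambda>i. c * x i) \<in> carrier swap_algebra" "adj swap_algebra x \<in> carrier swap_algebra"
proof -
  obtain a b where x: "ev x \<longlonglongrightarrow> a" "od x \<longlonglongrightarrow> b"
    "(\<lambda>k. ev x (swap k)) \<longlonglongrightarrow> a" "(\<lambda>k. od x (swap k)) \<longlonglongrightarrow> b"
    using swap_algebra_carrierE[OF x] .
  obtain a' b' where y: "ev y \<longlonglongrightarrow> a'" "od y \<longlonglongrightarrow> b'"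
    "(\<lambda>k. ev y (swap k)) \<longlonglongrightarrow> a'" "(\<lambda>k. od y (swap k)) \<longlonglongrightarrow> b'"
    using swap_algebra_carrierE[OF y] .
  show "x \<otimes>\<^bsub>swap_algebra\<^esub> y \<in> carrier swap_algebra"
    by (rule swap_algebra_carrierI[OF ev_simps(4) od_simps(4),
          where a = "a * a' + b * b'" and b = "a * b' + b * a'"]) (intro tendsto_intros x y)+
  show "(\<lambda>i. x i + y i) \<in> carrier swap_algebra"
    by (rule swap_algebra_carrierI[OF ev_simps(2) od_simps(2), where a = "a + a'" and b = "b + b'"])
       (intro tendsto_intros x y)+
  show "(\<lambda>i. c * x i) \<in> carrier swap_algebra"
    by (rule swap_algebra_carrierI[OF ev_simps(3) od_simps(3), where a = "c * a" and b = "c * b"])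
       (intro tendsto_intros x y)+
  show "adj swap_algebra x \<in> carrier swap_algebra"
    by (rule swap_algebra_carrierI[OF ev_simps(5) od_simps(5), where a = "cnj a" and b = "cnj b"])
       (intro tendsto_intros x y)+
qed

lemma swap_algebra_zero_closed: "(\<lambda>_. 0) \<in> carrier swap_algebra"
  by (rule swap_algebra_carrierI[OF ev_simps(1) od_simps(1), where a = 0 and b = 0]) simp_all

lemma vectorspace_swap_algebra: "vectorspace (class_ring :: complex ring) swap_algebra"
proof (rule vs_criteria)
  show "field (class_ring :: complex ring)" by (rule class_field.field_axioms)
  show "\<forall>v\<in>carrier swap_algebra. \<exists>neg_v\<in>carrier swap_algebra. v \<oplus>\<^bsub>swap_algebra\<^esub> neg_v = \<zero>\<^bsub>swap_algebra\<^esub>"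
  proof
    fix v assume "v \<in> carrier swap_algebra"
    then show "\<exists>neg_v\<in>carrier swap_algebra. v \<oplus>\<^bsub>swap_algebra\<^esub> neg_v = \<zero>\<^bsub>swap_algebra\<^esub>"
      using swap_algebra_closed(3)[of v v "-1"]
      by (intro bexI[of _ "\<lambda>i. - 1 * v i"]) (simp_all add: swap_algebra_simps(2,3))
  qed
qed (use swap_algebra_closed swap_algebra_zero_closed in
     \<open>auto simp: swap_algebra_simps(2-4) algebra_simps\<close>)

lemma swap_algebra_minus:
  assumes "x \<in> carrier swap_algebra" "y \<in> carrier swap_algebra"
  shows "x \<ominus>\<^bsub>swap_algebra\<^esub> y = (\<lambda>i. x i - y i)"
proof -
  interpret vectorspace "class_ring :: complex ring" swap_algebra by (rule vectorspace_swap_algebra)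
  have "\<ominus>\<^bsub>swap_algebra\<^esub> y = (\<lambda>i. - y i)"
    using smult_minus_1[OF assms(2)] by (simp add: class_ring_simps swap_algebra_simps(4))
  then show ?thesis by (simp add: a_minus_def swap_algebra_simps(3))
qed

section \<open>Completeness and the C*-algebra axioms\<close>

text \<open>This keeps the limit of a Cauchy sequence inside the algebra. Three differences of size
  at most \<open>e / 4\<close> leave room for a strict inequality.\<close>

lemma convergent_uniform_limit:
  fixes u :: "nat \<Rightarrow> nat \<Rightarrow> complex"
  assumes conv: "\<And>n. convergent (u n)"
    and unif: "\<And>e. e > 0 \<Longrightarrow> \<exists>n. \<forall>k. cmod (u n k - v k) \<le> e"
  shows "convergent v"
proof -
  have "Cauchy v"
  proof (rule CauchyI)
    fix e :: real assume "e > 0"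
    then obtain n where n: "\<And>k. cmod (u n k - v k) \<le> e / 4" using unif[of "e / 4"] by auto
    obtain N where N: "\<And>j k. \<lbrakk>j \<ge> N; k \<ge> N\<rbrakk> \<Longrightarrow> cmod (u n j - u n k) < e / 4"
      using CauchyD[OF convergent_Cauchy[OF conv[of n]], of "e / 4"] \<open>e > 0\<close> by auto
    show "\<exists>N. \<forall>j\<ge>N. \<forall>k\<ge>N. cmod (v j - v k) < e"
    proof (intro exI allI impI)
      fix j k assume jk: "j \<ge> N" "k \<ge> N"
      have "v j - v k = (u n j - u n k) - (u n j - v j) + (u n k - v k)" by simp
      also have "cmod \<dots> \<le> cmod (u n j - u n k) + cmod (u n j - v j) + cmod (u n k - v k)"
        by (meson norm_triangle_ineq norm_triangle_ineq4 order_trans add_right_mono)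
      also have "\<dots> < e" using N[OF jk] n[of j] n[of k] \<open>e > 0\<close> by simp
      finally show "cmod (v j - v k) < e" .
    qed
  qed
  then show ?thesis by (simp add: Cauchy_convergent_iff)
qed

lemma swap_algebra_complete:
  assumes X: "\<And>n. X n \<in> carrier swap_algebra"
    and Cauchy: "\<forall>e>0. \<exists>N. \<forall>m\<ge>N. \<forall>n\<ge>N. cnorm swap_algebra (X m \<ominus>\<^bsub>swap_algebra\<^esub> X n) < e"
  shows "\<exists>x\<in>carrier swap_algebra. (\<lambda>n. cnorm swap_algebra (X n \<ominus>\<^bsub>swap_algebra\<^esub> x)) \<longlonglongrightarrow> 0"
proof -
  interpret vectorspace "class_ring :: complex ring" swap_algebra by (rule vectorspace_swap_algebra)
  have unif: "\<exists>N. \<forall>m\<ge>N. \<forall>n\<ge>N. \<forall>i. cmod (X m i - X n i) < e" if e: "e > 0" for e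
  proof -
    obtain N where N: "\<forall>m\<ge>N. \<forall>n\<ge>N. cnorm swap_algebra (X m \<ominus>\<^bsub>swap_algebra\<^esub> X n) < e"
      using Cauchy e by blast
    have "cmod (X m i - X n i) < e" if "m \<ge> N" "n \<ge> N" for m n i
    proof -
      have "cmod ((X m \<ominus>\<^bsub>swap_algebra\<^esub> X n) i) \<le> cnorm swap_algebra (X m \<ominus>\<^bsub>swap_algebra\<^esub> X n)"
        using X by (intro cmod_le_cnorm minus_closed)
      also have "\<dots> < e" using N that by blast
      finally show ?thesis by (simp add: swap_algebra_minus X)
    qed
    then show ?thesis by blast
  qed
  have "Cauchy (\<lambda>n. X n i)" for i
  proof (rule CauchyI)
    fix e :: real assume "e > 0"
    then show "\<exists>M. \<forall>m\<ge>M. \<forall>n\<ge>M. norm (X m i - X n i) < e" using unif by blast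
  qed
  then have conv: "convergent (\<lambda>n. X n i)" for i by (simp add: Cauchy_convergent_iff)
  define x where "x i = lim (\<lambda>n. X n i)" for i
  have x: "(\<lambda>n. X n i) \<longlonglongrightarrow> x i" for i
    using conv[of i] by (simp add: x_def convergent_LIMSEQ_iff)
  \<comment> \<open>Letting \<open>m\<close> tend to infinity in the uniform Cauchy estimate makes
    the pointwise limit uniform.\<close>
  have lim: "\<exists>N. \<forall>n\<ge>N. \<forall>i. cmod (X n i - x i) \<le> e" if e: "e > 0" for e
  proof -
    obtain N where N: "\<And>m n i. \<lbrakk>m \<ge> N; n \<ge> N\<rbrakk> \<Longrightarrow> cmod (X m i - X n i) < e"
      using unif[OF e] by blast
    have "cmod (X n i - x i) \<le> e" if "n \<ge> N" for n i
    proof (rule LIMSEQ_le_const2)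
      show "(\<lambda>m. cmod (X n i - X m i)) \<longlonglongrightarrow> cmod (X n i - x i)"
        by (intro tendsto_intros x)
      show "\<exists>M. \<forall>m\<ge>M. cmod (X n i - X m i) \<le> e" using N[OF that] by (meson less_imp_le)
    qed
    then show ?thesis by blast
  qed
  have "convergent (ev x)"
  proof (rule convergent_uniform_limit[of "\<lambda>n. ev (X n)"])
    show "convergent (ev (X n))" for n using X[of n] by (simp add: swap_algebra_simps)
    show "\<exists>n. \<forall>k. cmod (ev (X n) k - ev x k) \<le> e" if "e > 0" for e
      using lim[OF that] unfolding ev_def by blast
  qed
  moreover have "convergent (od x)"
  proof (rule convergent_uniform_limit[of "\<lambda>n. od (X n)"])
    show "convergent (od (X n))" for n using X[of n] by (simp add: swap_algebra_simps)
    show "\<exists>n. \<forall>k. cmod (od (X n) k - od x k) \<le> e" if "e > 0" for e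
      using lim[OF that] unfolding od_def by blast
  qed
  ultimately have xc: "x \<in> carrier swap_algebra" by (simp add: swap_algebra_simps)
  have "(\<lambda>n. cnorm swap_algebra (X n \<ominus>\<^bsub>swap_algebra\<^esub> x)) \<longlonglongrightarrow> 0"
  proof (rule LIMSEQ_I)
    fix e :: real assume "e > 0"
    \<comment> \<open>The constant 4 relating the two norms turns \<open>e / 8\<close> into
      \<open>e / 2\<close>, strictly below \<open>e\<close>.\<close>
    then obtain N where N: "\<And>n i. n \<ge> N \<Longrightarrow> cmod (X n i - x i) \<le> e / 8"
      using lim[of "e / 8"] by auto
    have "norm (cnorm swap_algebra (X n \<ominus>\<^bsub>swap_algebra\<^esub> x) - 0) < e" if "n \<ge> N" for n
    proof -
      have "cnorm swap_algebra (X n \<ominus>\<^bsub>swap_algebra\<^esub> x) \<le> 4 * (e / 8)"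
        using N[OF that] by (intro cnorm_le_cmod) (simp add: swap_algebra_minus X xc)
      moreover have "0 \<le> cnorm swap_algebra (X n \<ominus>\<^bsub>swap_algebra\<^esub> x)"
        using norm_rep_le_cnorm[OF minus_closed[OF X[of n] xc], of 0] norm_ge_zero order_trans by blast
      ultimately show ?thesis using \<open>e > 0\<close> by simp
    qed
    then show "\<exists>N. \<forall>n\<ge>N. norm (cnorm swap_algebra (X n \<ominus>\<^bsub>swap_algebra\<^esub> x) - 0) < e" by blast
  qed
  then show ?thesis using xc by blast
qed

lemma cstar_algebra_swap_algebra: "cstar_algebra swap_algebra"
proof -
  let ?B = swap_algebra
  interpret vectorspace "class_ring :: complex ring" ?B by (rule vectorspace_swap_algebra)
  note simps = swap_algebra_simps(2-4)
  show ?thesis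
  proof unfold_locales
    fix x y z assume x: "x \<in> carrier ?B"
    show "adj ?B x \<in> carrier ?B" using swap_algebra_closed[OF x x] by blast
    show "adj ?B (adj ?B x) = x" by (rule ev_od_eqI) simp_all
    show "adj ?B (c \<odot>\<^bsub>?B\<^esub> x) = cnj c \<odot>\<^bsub>?B\<^esub> adj ?B x" for c
      by (rule ev_od_eqI) (simp_all add: simps)
    show ge: "0 \<le> cnorm ?B x" using norm_rep_le_cnorm[OF x, of 0] norm_ge_zero order_trans by blast
    show "cnorm ?B x = 0 \<longleftrightarrow> x = \<zero>\<^bsub>?B\<^esub>"
    proof
      assume "cnorm ?B x = 0"
      then show "x = \<zero>\<^bsub>?B\<^esub>" using cmod_le_cnorm[OF x] by (auto simp: simps)
    next
      assume "x = \<zero>\<^bsub>?B\<^esub>"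
      then show "cnorm ?B x = 0" using cnorm_le_cmod[of x 0] ge by (simp add: simps)
    qed
    show "cnorm ?B (c \<odot>\<^bsub>?B\<^esub> x) = cmod c * cnorm ?B x" for c
    proof -
      \<comment> \<open>The supremum gives one inequality; applied to the scalar
        \<open>1 / c\<close>, it gives the other.\<close>
      have le: "cnorm ?B (c \<odot>\<^bsub>?B\<^esub> x) \<le> cmod c * cnorm ?B x" if "x \<in> carrier ?B" for c x
        unfolding simps
        by (rule cnorm_swap_le) (simp add: norm_rep_scale mult_left_mono norm_rep_le_cnorm[OF that])
      show ?thesis
      proof (cases "c = 0")
        case True
        then show ?thesis using le[OF x, of c] norm_rep_le_cnorm[OF swap_algebra_zero_closed, of 0]
          by (simp add: simps order_antisym order_trans[OF norm_ge_zero])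
      next
        case False
        have "cnorm ?B x \<le> cmod (1 / c) * cnorm ?B (c \<odot>\<^bsub>?B\<^esub> x)"
          using le[of "c \<odot>\<^bsub>?B\<^esub> x" "1 / c"] swap_algebra_closed(3)[OF x x] False by (simp add: simps)
        then show ?thesis using le[OF x, of c] False by (simp add: norm_divide field_simps)
      qed
    qed
    show "cnorm ?B (adj ?B x \<otimes>\<^bsub>?B\<^esub> x) = (cnorm ?B x)\<^sup>2"
    proof (rule antisym)
      show "cnorm ?B (adj ?B x \<otimes>\<^bsub>?B\<^esub> x) \<le> (cnorm ?B x)\<^sup>2"
        by (rule cnorm_swap_le) (simp add: norm_rep_gram power_mono norm_rep_le_cnorm[OF x])
      have xx: "adj ?B x \<otimes>\<^bsub>?B\<^esub> x \<in> carrier ?B"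
        using swap_algebra_closed(1)[OF swap_algebra_closed(4)[OF x x] x] .
      have "cnorm ?B x \<le> sqrt (cnorm ?B (adj ?B x \<otimes>\<^bsub>?B\<^esub> x))"
        using norm_rep_le_cnorm[OF xx] by (intro cnorm_swap_le real_le_rsqrt) (simp add: norm_rep_gram)
      then have "(cnorm ?B x)\<^sup>2 \<le> (sqrt (cnorm ?B (adj ?B x \<otimes>\<^bsub>?B\<^esub> x)))\<^sup>2"
        using ge by (rule power_mono)
      moreover have "0 \<le> cnorm ?B (adj ?B x \<otimes>\<^bsub>?B\<^esub> x)"
        using norm_rep_le_cnorm[OF xx, of 0] norm_ge_zero order_trans by blast
      ultimately show "(cnorm ?B x)\<^sup>2 \<le> cnorm ?B (adj ?B x \<otimes>\<^bsub>?B\<^esub> x)" by simp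
    qed
    assume y: "y \<in> carrier ?B"
    show "x \<otimes>\<^bsub>?B\<^esub> y \<in> carrier ?B" by (rule swap_algebra_closed[OF x y])
    show "(c \<odot>\<^bsub>?B\<^esub> x) \<otimes>\<^bsub>?B\<^esub> y = c \<odot>\<^bsub>?B\<^esub> (x \<otimes>\<^bsub>?B\<^esub> y)" for c
      by (rule ev_od_eqI) (simp_all add: simps algebra_simps)
    show "x \<otimes>\<^bsub>?B\<^esub> (c \<odot>\<^bsub>?B\<^esub> y) = c \<odot>\<^bsub>?B\<^esub> (x \<otimes>\<^bsub>?B\<^esub> y)" for c
      by (rule ev_od_eqI) (simp_all add: simps algebra_simps)
    show "adj ?B (x \<oplus>\<^bsub>?B\<^esub> y) = adj ?B x \<oplus>\<^bsub>?B\<^esub> adj ?B y"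
      by (rule ev_od_eqI) (simp_all add: simps)
    show "adj ?B (x \<otimes>\<^bsub>?B\<^esub> y) = adj ?B y \<otimes>\<^bsub>?B\<^esub> adj ?B x"
      by (rule ev_od_eqI) (simp_all add: simps algebra_simps)
    show "cnorm ?B (x \<oplus>\<^bsub>?B\<^esub> y) \<le> cnorm ?B x + cnorm ?B y"
      unfolding simps
    proof (rule cnorm_swap_le)
      fix k show "norm (rep (\<lambda>i. x i + y i) k) \<le> cnorm ?B x + cnorm ?B y"
        using norm_triangle_ineq[of "rep x k" "rep y k"] norm_rep_le_cnorm[OF x, of k]
          norm_rep_le_cnorm[OF y, of k] by (simp add: rep_add)
    qed
    show "cnorm ?B (x \<otimes>\<^bsub>?B\<^esub> y) \<le> cnorm ?B x * cnorm ?B y"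
    proof (rule cnorm_swap_le)
      fix k
      have "norm (rep x k) * norm (rep y k) \<le> cnorm ?B x * cnorm ?B y"
        using ge by (intro mult_mono norm_rep_le_cnorm x y) simp_all
      then show "norm (rep (x \<otimes>\<^bsub>?B\<^esub> y) k) \<le> cnorm ?B x * cnorm ?B y"
        using norm_blinfun_compose[of "rep x k" "rep y k"] by (simp add: rep_mult)
    qed
    show "(x \<otimes>\<^bsub>?B\<^esub> y) \<otimes>\<^bsub>?B\<^esub> z = x \<otimes>\<^bsub>?B\<^esub> (y \<otimes>\<^bsub>?B\<^esub> z)"
      by (rule ev_od_eqI) (simp_all add: algebra_simps)
    show "(x \<oplus>\<^bsub>?B\<^esub> y) \<otimes>\<^bsub>?B\<^esub> z = x \<otimes>\<^bsub>?B\<^esub> z \<oplus>\<^bsub>?B\<^esub> y \<otimes>\<^bsub>?B\<^esub> z"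
      by (rule ev_od_eqI) (simp_all add: simps algebra_simps)
    show "x \<otimes>\<^bsub>?B\<^esub> (y \<oplus>\<^bsub>?B\<^esub> z) = x \<otimes>\<^bsub>?B\<^esub> y \<oplus>\<^bsub>?B\<^esub> x \<otimes>\<^bsub>?B\<^esub> z"
      by (rule ev_od_eqI) (simp_all add: simps algebra_simps)
  next
    fix X :: "nat \<Rightarrow> nat \<Rightarrow> complex"
    assume "\<And>n. X n \<in> carrier ?B"
      "\<forall>e>0. \<exists>N. \<forall>m\<ge>N. \<forall>n\<ge>N. cnorm ?B (X m \<ominus>\<^bsub>?B\<^esub> X n) < e"
    then show "\<exists>x\<in>carrier ?B. (\<lambda>n. cnorm ?B (X n \<ominus>\<^bsub>?B\<^esub> x)) \<longlonglongrightarrow> 0"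
      by (rule swap_algebra_complete)
  qed
qed

section \<open>The diagonal\<close>

abbreviation diag :: "(nat \<Rightarrow> complex) set" where
  "diag \<equiv> {x \<in> carrier swap_algebra. \<forall>k. od x k = 0}"

text \<open>The orbits below \<open>2 * n\<close> contribute \<open>n\<close> full 2x2 matrix
  algebras and the constant tail one copy of the group algebra of Z/2, so the dimension is
  \<open>4 * n + 2\<close>.\<close>

definition stage :: "nat \<Rightarrow> (nat \<Rightarrow> complex) set" where
  "stage n = {x. \<exists>a b. \<forall>k\<ge>2 * n. ev x k = a \<and> od x k = b}"

definition ind :: "nat set \<Rightarrow> nat \<Rightarrow> complex" where
  "ind P k = (if k \<in> P then 1 else 0)"

text \<open>These code the indicator of \<open>P\<close> and the indicator of \<open>P\<close> times
  \<open>u\<close>. With \<open>P\<close> ranging over \<open>blocks n\<close> they span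
  \<open>stage n\<close>.\<close>

definition unit0 :: "nat set \<Rightarrow> nat \<Rightarrow> complex" where "unit0 P = join (ind P) (\<lambda>_. 0)"
definition unit1 :: "nat set \<Rightarrow> nat \<Rightarrow> complex" where "unit1 P = join (\<lambda>_. 0) (ind P)"

definition blocks :: "nat \<Rightarrow> nat set set" where
  "blocks n = insert {2 * n..} ((\<lambda>k. {k}) ` {..<2 * n})"

interpretation sw: cstar_algebra swap_algebra
  by (rule cstar_algebra_swap_algebra)

section \<open>Finite stages, approximation and spanning sets\<close>

lemma eventually_const_convergent:
  fixes f :: "nat \<Rightarrow> complex"
  shows "(\<And>k. k \<ge> n \<Longrightarrow> f k = c) \<Longrightarrow> convergent f"
  unfolding convergent_def
  by (intro exI[of _ c] tendsto_eventually) (auto simp: eventually_sequentially)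

lemma stageI:
  "(\<And>k. k \<ge> 2 * n \<Longrightarrow> ev x k = a) \<Longrightarrow> (\<And>k. k \<ge> 2 * n \<Longrightarrow> od x k = b) \<Longrightarrow> x \<in> stage n"
  unfolding stage_def by blast

lemma stageE:
  assumes "x \<in> stage n"
  obtains a b where "\<forall>k\<ge>2 * n. ev x k = a" "\<forall>k\<ge>2 * n. od x k = b"
  using assms unfolding stage_def by blast

lemma stage_subset_carrier: "stage n \<subseteq> carrier swap_algebra"
  unfolding swap_algebra_simps
  by (auto elim!: stageE intro: eventually_const_convergent[of "2 * n"])

lemma norm_closure_swap:
  assumes "S \<subseteq> carrier swap_algebra" "x \<in> norm_closure swap_algebra S" "e > 0"
  shows "\<exists>s\<in>S. \<forall>i. cmod (x i - s i) < e"
proof -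
  obtain s where s: "s \<in> S" "cnorm swap_algebra (x \<ominus>\<^bsub>swap_algebra\<^esub> s) < e"
    using assms by (auto simp: norm_closure_def)
  have c: "x \<in> carrier swap_algebra" "s \<in> carrier swap_algebra"
    using assms s by (auto simp: norm_closure_def)
  have "cmod (x i - s i) < e" for i
    using cmod_le_cnorm[OF sw.minus_closed[OF c], of i] s(2) by (simp add: swap_algebra_minus[OF c])
  then show ?thesis using s(1) by blast
qed

lemma star_subalgebra_stage: "star_subalgebra swap_algebra (stage n)"
proof (rule sw.star_subalgebraI)
  fix x y assume x: "x \<in> stage n" and y: "y \<in> stage n"
  obtain a b where x: "\<forall>k\<ge>2 * n. ev x k = a" "\<forall>k\<ge>2 * n. od x k = b"
    using stageE[OF x] .
  obtain c d where y: "\<forall>k\<ge>2 * n. ev y k = c" "\<forall>k\<ge>2 * n. od y k = d"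
    using stageE[OF y] .
  show "x \<oplus>\<^bsub>swap_algebra\<^esub> y \<in> stage n"
    by (rule stageI[where a = "a + c" and b = "b + d"]) (simp_all add: swap_algebra_simps(3) x y)
  show "x \<otimes>\<^bsub>swap_algebra\<^esub> y \<in> stage n"
    by (rule stageI[where a = "a * c + b * d" and b = "a * d + b * c"]) (simp_all add: x y swap_ge)
next
  fix x assume x: "x \<in> stage n"
  obtain a b where x: "\<forall>k\<ge>2 * n. ev x k = a" "\<forall>k\<ge>2 * n. od x k = b"
    using stageE[OF x] .
  show "adj swap_algebra x \<in> stage n"
    by (rule stageI[where a = "cnj a" and b = "cnj b"]) (simp_all add: x swap_ge)
  show "c \<odot>\<^bsub>swap_algebra\<^esub> x \<in> stage n" for c
    by (rule stageI[where a = "c * a" and b = "c * b"]) (simp_all add: swap_algebra_simps(4) x)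
qed (use stage_subset_carrier in \<open>auto simp: swap_algebra_simps(2) intro!: stageI\<close>)

lemma eq_if_close: "(\<And>e. e > 0 \<Longrightarrow> cmod (a - b) < e) \<Longrightarrow> a = b"
  using zero_less_norm_iff[of "a - b"] by (metis less_irrefl right_minus_eq)

text \<open>Membership in \<open>stage n\<close> amounts to equalities between coordinates, and
  these survive uniform approximation.\<close>

lemma cstar_subalgebra_stage: "cstar_subalgebra swap_algebra (stage n)"
proof -
  have "x \<in> stage n" if x: "x \<in> norm_closure swap_algebra (stage n)" for x
  proof -
    have close: "cmod (x i - x j) < e" if e: "e > 0" and ij: "\<And>s. s \<in> stage n \<Longrightarrow> s i = s j" for i j e
    proof -
      obtain s where s: "s \<in> stage n" "\<And>i. cmod (x i - s i) < e / 2"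
        using norm_closure_swap[OF stage_subset_carrier x, of "e / 2"] e by auto
      have "cmod (x i - x j) \<le> cmod (x i - s i) + cmod (x j - s j)"
        using norm_triangle_ineq4[of "x i - s i" "x j - s j"] ij[OF s(1)] by simp
      then show ?thesis using s(2)[of i] s(2)[of j] by linarith
    qed
    show ?thesis
    proof (rule stageI)
      fix k assume "k \<ge> 2 * n"
      then show "ev x k = ev x (2 * n)" "od x k = od x (2 * n)"
        unfolding ev_def od_def
        by (intro eq_if_close close; force elim: stageE simp: ev_def od_def)+
    qed
  qed
  then have "norm_closure swap_algebra (stage n) = stage n"
    using sw.norm_closure_superset[OF stage_subset_carrier] by blast
  then show ?thesis using star_subalgebra_stage by (simp add: cstar_subalgebra_def)
qed

lemma cstar_subalgebra_diag: "cstar_subalgebra swap_algebra diag"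
proof -
  have star: "star_subalgebra swap_algebra diag"
    by (rule sw.star_subalgebraI)
       (auto simp: swap_algebra_simps(2-4) swap_algebra_closed swap_algebra_zero_closed)
  have "norm_closure swap_algebra diag \<subseteq> diag"
  proof
    fix x assume x: "x \<in> norm_closure swap_algebra diag"
    have "od x k = 0" for k
    proof (rule eq_if_close)
      fix e :: real assume e: "e > 0"
      obtain s where s: "s \<in> diag" "\<And>i. cmod (x i - s i) < e"
        using norm_closure_swap[OF _ x e] by auto
      show "cmod (od x k - 0) < e" using s(1) s(2)[of "Suc (2 * k)"] by (simp add: od_def)
    qed
    then show "x \<in> diag" using x by (simp add: norm_closure_def)
  qed
  moreover have "diag \<subseteq> norm_closure swap_algebra diag"
    by (rule sw.norm_closure_superset) blast
  ultimately show ?thesis unfolding cstar_subalgebra_def using star by (intro conjI equalityI)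
qed

text \<open>Beyond \<open>2 * n\<close> both sequences are replaced by their limits. For diagonal
  \<open>x\<close> the second limit is 0, so the same truncation serves the AF property of the
  algebra and of the masa.\<close>

lemma stage_approx:
  assumes x: "x \<in> carrier swap_algebra" and e: "e > 0"
  shows "\<exists>n. \<exists>s\<in>stage n. (x \<in> diag \<longrightarrow> s \<in> diag) \<and> cnorm swap_algebra (x \<ominus>\<^bsub>swap_algebra\<^esub> s) < e"
proof -
  obtain a b where ab: "ev x \<longlonglongrightarrow> a" "od x \<longlonglongrightarrow> b" using swap_algebra_carrierE[OF x] .
  have "e / 8 > 0" using e by simp
  obtain N where N: "\<And>k. k \<ge> N \<Longrightarrow> cmod (ev x k - a) < e / 8"
    using LIMSEQ_D[OF ab(1) \<open>e / 8 > 0\<close>] by auto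
  obtain M where M: "\<And>k. k \<ge> M \<Longrightarrow> cmod (od x k - b) < e / 8"
    using LIMSEQ_D[OF ab(2) \<open>e / 8 > 0\<close>] by auto
  define n where "n = max M N"
  define s where "s = join (\<lambda>k. if k < 2 * n then ev x k else a) (\<lambda>k. if k < 2 * n then od x k else b)"
  have s: "s \<in> stage n" unfolding s_def by (rule stageI[where a = a and b = b]) simp_all
  have sc: "s \<in> carrier swap_algebra" using s stage_subset_carrier by blast
  have "s \<in> diag" if "x \<in> diag"
  proof -
    have "od x = (\<lambda>_. 0)" using that by auto
    then have "b = 0" using ab(2) LIMSEQ_unique tendsto_const by metis
    then show ?thesis using that sc by (simp add: s_def)
  qed
  moreover have "cnorm swap_algebra (x \<ominus>\<^bsub>swap_algebra\<^esub> s) \<le> 4 * (e / 8)"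
  proof (rule cnorm_le_cmod)
    have "cmod (ev x k - ev s k) \<le> e / 8 \<and> cmod (od x k - od s k) \<le> e / 8" for k
      using N[of k] M[of k] e by (auto simp: s_def n_def intro: less_imp_le)
    then have "cmod ((\<lambda>i. x i - s i) i) \<le> e / 8" for i
      using forall_ev_od[of "\<lambda>z. cmod z \<le> e / 8" "\<lambda>i. x i - s i"] by (simp add: ev_def od_def)
    then show "cmod ((x \<ominus>\<^bsub>swap_algebra\<^esub> s) i) \<le> e / 8" for i
      by (simp add: swap_algebra_minus[OF x sc])
  qed
  ultimately show ?thesis using s e by (intro exI[of _ n] bexI[of _ s]) auto
qed

text \<open>\<open>W\<close> is arbitrary so that it can stand for any subspace in a
  finite-dimension proof and also for the C*-algebra generated by the normaliser. The alternative in
  the last hypothesis allows the diagonal part of a stage to be spanned by the \<open>unit0\<close>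
  elements alone.\<close>

lemma stage_spanned:
  assumes W: "subspace (class_ring :: complex ring) W swap_algebra" and x: "x \<in> stage n"
    and u0: "\<And>P. P \<in> blocks n \<Longrightarrow> unit0 P \<in> W"
    and u1: "\<And>P. P \<in> blocks n \<Longrightarrow> unit1 P \<in> W \<or> (\<forall>k. od x k = 0)"
  shows "x \<in> W"
proof -
  note W' = sw.subspaceD[OF W, unfolded swap_algebra_simps(2-4)]
  obtain a b where ab: "\<forall>k\<ge>2 * n. ev x k = a" "\<forall>k\<ge>2 * n. od x k = b"
    using stageE[OF x] .
  have t0: "(\<lambda>i. c * unit0 P i) \<in> W" if "P \<in> blocks n" for c P using W'(4)[OF u0[OF that]] .
  have t1: "(\<lambda>i. od x k * unit1 P i) \<in> W" if "P \<in> blocks n" for k P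
    using u1[OF that] W'(2) W'(4) by auto
  \<comment> \<open>\<open>part m\<close> keeps the values of \<open>x\<close> at the first
    \<open>m\<close> points. It grows by one singleton block at a time, and the tail block completes
    \<open>x\<close>.\<close>
  define part where "part m = join (\<lambda>k. if k < m then ev x k else 0) (\<lambda>k. if k < m then od x k else 0)" for m
  have "m \<le> 2 * n \<Longrightarrow> part m \<in> W" for m
  proof (induction m)
    case 0
    have "part 0 = (\<lambda>_. 0)" by (rule ev_od_eqI) (simp_all add: part_def)
    then show ?case using W'(2) by simp
  next
    case (Suc m)
    have bl: "{m} \<in> blocks n" using Suc.prems by (auto simp: blocks_def)
    have "part (Suc m) = (\<lambda>i. part m i + (ev x m * unit0 {m} i + od x m * unit1 {m} i))"
      by (rule ev_od_eqI) (auto simp: part_def unit0_def unit1_def ind_def less_Suc_eq)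
    also have "\<dots> \<in> W" using Suc by (intro W'(3) t0 t1 bl) simp
    finally show ?case .
  qed
  then have p: "part (2 * n) \<in> W" by simp
  have bl: "{2 * n..} \<in> blocks n" by (simp add: blocks_def)
  have "x = (\<lambda>i. part (2 * n) i + (ev x (2 * n) * unit0 {2 * n..} i + od x (2 * n) * unit1 {2 * n..} i))"
    by (rule ev_od_eqI) (auto simp: part_def unit0_def unit1_def ind_def ab)
  also have "\<dots> \<in> W" by (intro W'(3) p t0 t1 bl)
  finally show ?thesis .
qed

lemma unit_stage:
  assumes "P \<in> blocks n"
  shows "unit0 P \<in> stage n" "unit1 P \<in> stage n"
proof -
  have "(\<forall>k\<ge>2 * n. ind P k = 1) \<or> (\<forall>k\<ge>2 * n. ind P k = 0)"
    using assms by (auto simp: blocks_def ind_def)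
  then obtain c where "\<forall>k\<ge>2 * n. ind P k = c" by blast
  then show "unit0 P \<in> stage n" "unit1 P \<in> stage n"
    by (auto simp: unit0_def unit1_def stage_def)
qed

lemma unit0_diag: "P \<in> blocks n \<Longrightarrow> unit0 P \<in> diag"
  using unit_stage(1) stage_subset_carrier by (auto simp: unit0_def)

lemma finite_blocks: "finite (blocks n)"
  by (simp add: blocks_def)

lemma subspace_of_cstar_subalgebra:
  "cstar_subalgebra B S \<Longrightarrow> subspace (class_ring :: complex ring) S B"
  by (simp add: cstar_subalgebra_def star_subalgebra_def subalgebra_def)

lemma cstar_subalgebra_Int:
  assumes "cstar_subalgebra swap_algebra S" "cstar_subalgebra swap_algebra T"
  shows "cstar_subalgebra swap_algebra (S \<inter> T)"
proof -
  have S: "star_subalgebra swap_algebra S" "norm_closure swap_algebra S = S"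
    and T: "star_subalgebra swap_algebra T" "norm_closure swap_algebra T = T"
    using assms by (simp_all add: cstar_subalgebra_def)
  note S' = sw.star_subalgebraD[OF S(1)] and T' = sw.star_subalgebraD[OF T(1)]
  have "star_subalgebra swap_algebra (S \<inter> T)"
    by (rule sw.star_subalgebraI) (use S'(1) in \<open>auto simp: S'(2-7) T'(2-7)\<close>)
  moreover have "norm_closure swap_algebra (S \<inter> T) = S \<inter> T"
    using norm_closure_mono[of "S \<inter> T" S swap_algebra] norm_closure_mono[of "S \<inter> T" T swap_algebra]
      sw.norm_closure_superset[of "S \<inter> T"] S(2) T(2) S'(1) by blast
  ultimately show ?thesis by (simp add: cstar_subalgebra_def)
qed

lemma stage_mono: "stage n \<subseteq> stage (Suc n)"
  by (auto elim!: stageE intro: stageI)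

lemma norm_closure_stages: "norm_closure swap_algebra (\<Union>n. stage n) = carrier swap_algebra"
proof (intro equalityI subsetI)
  fix x assume x: "x \<in> carrier swap_algebra"
  show "x \<in> norm_closure swap_algebra (\<Union>n. stage n)"
    unfolding norm_closure_def
  proof (intro CollectI conjI allI impI x)
    fix e :: real assume "e > 0"
    from stage_approx[OF x this]
    show "\<exists>s\<in>\<Union>n. stage n. cnorm swap_algebra (x \<ominus>\<^bsub>swap_algebra\<^esub> s) < e" by blast
  qed
qed (simp add: norm_closure_def)

section \<open>The AF property\<close>

lemma AF_swap_algebra: "AF_algebra swap_algebra"
  unfolding AF_algebra_def
proof (intro conjI exI[of _ stage] allI)
  show "finite_dim (on_carrier swap_algebra (stage n))" for n
    by (rule sw.finite_dim_on_carrierI[OF subspace_of_cstar_subalgebra[OF cstar_subalgebra_stage],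
          of "unit0 ` blocks n \<union> unit1 ` blocks n"])
       (use unit_stage in \<open>auto simp: finite_blocks image_subset_iff intro: stage_spanned\<close>)
qed (fact sw.cstar_algebra_axioms cstar_subalgebra_stage stage_mono norm_closure_stages)+

lemma AF_diag: "AF_algebra (on_carrier swap_algebra diag)"
  unfolding AF_algebra_def
proof (intro conjI exI[of _ "\<lambda>n. stage n \<inter> diag"] allI)
  note sub = subspace_of_cstar_subalgebra[OF cstar_subalgebra_diag]
  note int = cstar_subalgebra_Int[OF cstar_subalgebra_stage cstar_subalgebra_diag]
  show "cstar_algebra (on_carrier swap_algebra diag)"
    by (rule sw.cstar_algebra_on_carrier[OF cstar_subalgebra_diag])
  show "cstar_subalgebra (on_carrier swap_algebra diag) (stage n \<inter> diag)" for n
    by (rule sw.cstar_subalgebra_on_carrier[OF sub int]) simp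
  have "finite_dim (on_carrier swap_algebra (stage n \<inter> diag))" for n
    by (rule sw.finite_dim_on_carrierI[OF subspace_of_cstar_subalgebra[OF int], of "unit0 ` blocks n"])
       (use unit_stage unit0_diag in \<open>auto simp: finite_blocks image_subset_iff intro: stage_spanned\<close>)
  then show "finite_dim (on_carrier (on_carrier swap_algebra diag) (stage n \<inter> diag))" for n by simp
  show "stage n \<inter> diag \<subseteq> stage (Suc n) \<inter> diag" for n using stage_mono by blast
  have "norm_closure (on_carrier swap_algebra diag) (\<Union>n. stage n \<inter> diag)
      = norm_closure swap_algebra (\<Union>n. stage n \<inter> diag) \<inter> diag"
    by (rule sw.norm_closure_on_carrier[OF sub]) blast
  also have "\<dots> = diag"
  proof -
    have "x \<in> norm_closure swap_algebra (\<Union>n. stage n \<inter> diag)" if x: "x \<in> diag" for x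
      unfolding norm_closure_def
    proof (intro CollectI conjI allI impI)
      show xc: "x \<in> carrier swap_algebra" using x by blast
      fix e :: real assume "e > 0"
      from stage_approx[OF xc this]
      show "\<exists>s\<in>\<Union>n. stage n \<inter> diag. cnorm swap_algebra (x \<ominus>\<^bsub>swap_algebra\<^esub> s) < e"
        using x by blast
    qed
    then show ?thesis by blast
  qed
  finally show "norm_closure (on_carrier swap_algebra diag) (\<Union>n. stage n \<inter> diag)
      = carrier (on_carrier swap_algebra diag)" by simp
qed

section \<open>Maximality and regularity of the diagonal\<close>

text \<open>Commuting with the indicator of a single point \<open>k\<close> forces
  \<open>od x k = 0\<close>, because the orbit partner of \<open>k\<close> is a different point. At
  infinity the coefficient then vanishes as a limit.\<close>

lemma masa_diag: "masa swap_algebra (carrier swap_algebra) diag"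
  unfolding masa_def
proof (intro conjI allI impI)
  show "abelian_star_subalgebra swap_algebra diag"
    using cstar_subalgebra_diag
    by (auto simp: abelian_star_subalgebra_def cstar_subalgebra_def intro!: ev_od_eqI)
  fix D' assume D': "abelian_star_subalgebra swap_algebra D' \<and> D' \<subseteq> carrier swap_algebra \<and> diag \<subseteq> D'"
  have "od x k = 0" if x: "x \<in> D'" for x k
  proof -
    have "{k} \<in> blocks (Suc k)" by (auto simp: blocks_def)
    then have "unit0 {k} \<in> D'" using D' unit0_diag by blast
    then have "x \<otimes>\<^bsub>swap_algebra\<^esub> unit0 {k} = unit0 {k} \<otimes>\<^bsub>swap_algebra\<^esub> x"
      using D' x by (auto simp: abelian_star_subalgebra_def)
    \<comment> \<open>The left side is \<open>od x k\<close> times the indicator of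
      \<open>{k}\<close> at \<open>swap k\<close>, which is 0; the right side is
      \<open>od x k\<close>.\<close>
    then have "od (x \<otimes>\<^bsub>swap_algebra\<^esub> unit0 {k}) k = od (unit0 {k} \<otimes>\<^bsub>swap_algebra\<^esub> x) k" by simp
    then show ?thesis by (simp add: unit0_def ind_def)
  qed
  then show "D' = diag" using D' by blast
qed blast

text \<open>Conjugating a function \<open>f\<close> by the indicator of \<open>P\<close> times
  \<open>u\<close> gives \<open>f \<circ> swap\<close> cut down to \<open>P\<close>; conjugating by
  its adjoint gives \<open>f \<circ> swap\<close> cut down to the image of \<open>P\<close> under
  \<open>swap\<close>. Both are diagonal.\<close>

lemma unit_normaliser:
  assumes "P \<in> blocks n"
  shows "unit0 P \<in> normaliser swap_algebra (carrier swap_algebra) diag"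
    "unit1 P \<in> normaliser swap_algebra (carrier swap_algebra) diag"
proof -
  have u: "unit0 P \<in> carrier swap_algebra" "unit1 P \<in> carrier swap_algebra"
    using unit_stage[OF assms] stage_subset_carrier by blast+
  have [simp]: "cnj (ind P k) = ind P k" "ind P k * ind P k = ind P k" for k
    by (simp_all add: ind_def)
  show "unit0 P \<in> normaliser swap_algebra (carrier swap_algebra) diag"
    unfolding normaliser_def partial_isometry_def projection_def
    using u by (auto simp: swap_algebra_closed unit0_def intro!: ev_od_eqI)
  show "unit1 P \<in> normaliser swap_algebra (carrier swap_algebra) diag"
    unfolding normaliser_def partial_isometry_def projection_def
    using u by (auto simp: swap_algebra_closed unit1_def intro!: ev_od_eqI)
qed

lemma regular_diag: "regular_masa swap_algebra diag"
proof -
  let ?N = "normaliser swap_algebra (carrier swap_algebra) diag"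
  have "?N \<subseteq> carrier swap_algebra" by (auto simp: normaliser_def)
  note gen = sw.generated_cstar[OF this]
  define G where "G = generated_cstar swap_algebra ?N"
  have G: "cstar_subalgebra swap_algebra G" "?N \<subseteq> G" using gen by (simp_all add: G_def)
  \<comment> \<open>The generated algebra is a subspace containing all \<open>unit0 P\<close> and
    \<open>unit1 P\<close>, hence every stage; being closed, it is everything.\<close>
  have "stage n \<subseteq> G" for n
  proof
    fix x assume "x \<in> stage n"
    then show "x \<in> G"
      by (rule stage_spanned[OF subspace_of_cstar_subalgebra[OF G(1)]])
         (use unit_normaliser G(2) in blast)+
  qed
  then have "norm_closure swap_algebra (\<Union>n. stage n) \<subseteq> norm_closure swap_algebra G"
    by (intro norm_closure_mono) blast
  then have "carrier swap_algebra \<subseteq> G"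
    using G(1) by (simp add: norm_closure_stages cstar_subalgebra_def)
  moreover have "G \<subseteq> carrier swap_algebra"
    using sw.subspaceD(1)[OF subspace_of_cstar_subalgebra[OF G(1)]] .
  ultimately show ?thesis using masa_diag by (simp add: regular_masa_def G_def)
qed

section \<open>The two characters at infinity\<close>

text \<open>Evaluation at infinity lands in the group algebra of Z/2, and \<open>z\<close> is the
  value assigned to \<open>u\<close>.\<close>

definition end_character :: "complex \<Rightarrow> (nat \<Rightarrow> complex) \<Rightarrow> complex" where
  "end_character z x = lim (ev x) + z * lim (od x)"

lemma end_character_eqI:
  "\<lbrakk>\<And>k. ev x k = f k; \<And>k. od x k = g k; f \<longlonglongrightarrow> a; g \<longlonglongrightarrow> b\<rbrakk> \<Longrightarrow> end_character z x = a + z * b"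
  unfolding end_character_def by (metis ext limI)

lemma character_end:
  assumes z: "z * z = 1"
  shows "character_on swap_algebra (carrier swap_algebra) (end_character z)"
  unfolding character_on_def
proof (intro conjI ballI allI)
  fix x y assume x: "x \<in> carrier swap_algebra" and y: "y \<in> carrier swap_algebra"
  obtain a b where x: "ev x \<longlonglongrightarrow> a" "od x \<longlonglongrightarrow> b"
    "(\<lambda>k. ev x (swap k)) \<longlonglongrightarrow> a" "(\<lambda>k. od x (swap k)) \<longlonglongrightarrow> b"
    using swap_algebra_carrierE[OF x] .
  obtain a' b' where y: "ev y \<longlonglongrightarrow> a'" "od y \<longlonglongrightarrow> b'"
    "(\<lambda>k. ev y (swap k)) \<longlonglongrightarrow> a'" "(\<lambda>k. od y (swap k)) \<longlonglongrightarrow> b'"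
    using swap_algebra_carrierE[OF y] .
  have ex: "end_character z x = a + z * b" by (rule end_character_eqI[OF refl refl x(1,2)])
  have ey: "end_character z y = a' + z * b'" by (rule end_character_eqI[OF refl refl y(1,2)])
  have "end_character z (x \<oplus>\<^bsub>swap_algebra\<^esub> y) = (a + a') + z * (b + b')"
    unfolding swap_algebra_simps
    by (rule end_character_eqI[OF ev_simps(2) od_simps(2)]) (rule tendsto_add x y)+
  then show "end_character z (x \<oplus>\<^bsub>swap_algebra\<^esub> y) = end_character z x + end_character z y"
    by (simp add: ex ey algebra_simps)
  have "end_character z (x \<otimes>\<^bsub>swap_algebra\<^esub> y) = (a * a' + b * b') + z * (a * b' + b * a')"
    by (rule end_character_eqI[OF ev_simps(4) od_simps(4)]) (intro tendsto_add tendsto_mult x y)+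
  \<comment> \<open>The deviation from multiplicativity is a multiple of \<open>1 - z * z\<close>;
    this is where \<open>z\<close> must be a square root of 1.\<close>
  also have "\<dots> = (a + z * b) * (a' + z * b') + (1 - z * z) * (b * b')" by (simp add: algebra_simps)
  finally show "end_character z (x \<otimes>\<^bsub>swap_algebra\<^esub> y) = end_character z x * end_character z y"
    by (simp add: ex ey z)
next
  fix c x assume x: "x \<in> carrier swap_algebra"
  obtain a b where x: "ev x \<longlonglongrightarrow> a" "od x \<longlonglongrightarrow> b" using swap_algebra_carrierE[OF x] .
  have ex: "end_character z x = a + z * b" by (rule end_character_eqI[OF refl refl x(1,2)])
  have "end_character z (c \<odot>\<^bsub>swap_algebra\<^esub> x) = c * a + z * (c * b)"
    unfolding swap_algebra_simps
    by (rule end_character_eqI[OF ev_simps(3) od_simps(3)]) (rule tendsto_mult tendsto_const x)+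
  then show "end_character z (c \<odot>\<^bsub>swap_algebra\<^esub> x) = c * end_character z x"
    by (simp add: ex algebra_simps)
qed

lemma not_standard_diag: "\<not> standard_regular_masa swap_algebra diag"
proof
  assume std: "standard_regular_masa swap_algebra diag"
  \<comment> \<open>The code of the unitary \<open>u\<close>, at which the two characters have the
    values 1 and -1.\<close>
  let ?u = "join (\<lambda>_. 0) (\<lambda>_. 1)"
  have u: "?u \<in> carrier swap_algebra" by (simp add: swap_algebra_simps convergent_const)
  have "end_character 1 ?u = end_character (- 1) ?u"
  proof (rule standard_regular_masa_characters_agree[OF std character_end character_end _ u])
    fix d assume "d \<in> diag"
    then have "od d = (\<lambda>_. 0)" by auto
    then show "end_character 1 d = end_character (- 1) d" by (simp add: end_character_def)
  qed simp_all
  then show False by (simp add: end_character_def)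
qed

theorem theorem2p3:
  shows "\<exists>(B :: (nat \<Rightarrow> complex) cstar) D.
    AF_algebra B \<and> masa B (carrier B) D \<and> AF_algebra (on_carrier B D) \<and>
    regular_masa B D \<and> \<not> standard_regular_masa B D"
  using AF_swap_algebra masa_diag AF_diag regular_diag not_standard_diag by blast

end
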